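(* Let $\mathcal X$ be a finite alphabet, and let $\{Q(x^n)\}_{n\ge1}$ be a sequence of probability mass functions, $Q(x^n)$ being a probability mass function on $\mathcal X^n$, such that for every stationary distribution $P$ on $\mathcal X^{\mathbb Z}$ one has $$\frac1nI(P_{X^n}\,|\,Q_{X^n})\to0\qquad\text{or}\qquad\frac1n\log\left(\frac{P(X^n)}{Q(X^n)}\right)\to0\ \text{ in }L^1(P).$$ Define the conditional probability mass function estimates $$\hat P(x\mid X^{-n})=\frac1n\sum_{0\le t<n}Q(x\mid X^{-t}),\qquad n\ge1,\ x\in\mathcal X,$$ with $Q(x\mid X^{-t})$ as explained in the context. Then the estimates $\hat P(x\mid X^{-n})$ are consistent in expected information divergence for the class of all stationary process distributions on $\mathcal X^{\mathbb Z}$: for every stationary $P$, $$E_P\{I(P_{X|X^-}\,|\,\hat P_{X|X^{-n}})\}\to0\quad\text{as }n\to\infty.$$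
   Context: Notation: $\{X_t\}_{t\in\mathbb Z}$ is the coordinate process on $\mathcal X^{\mathbb Z}$; $X=X_0$; $X^t=(X_0,\ldots,X_{t-1})$; $X^{-t}=(X_{-t},\ldots,X_{-1})$ (empty for $t=0$); $X^-=(\ldots,X_{-2},X_{-1})$; $P_{X^n}$, with mass function $P(x^n)$, is the law of $X^n$ under $P$. Logarithms are in base 2. $I(P|Q)$ is the Kullback–Leibler divergence $\sum P\log(P/Q)$ (equal to $+\infty$ if $P$ is not dominated by $Q$), and $$I(P_{X|X^-}\,|\,\hat P_{X|X^{-n}})=\sum_{x\in\mathcal X}P(x\mid X^-)\log\left(\frac{P(x\mid X^-)}{\hat P(x\mid X^{-n})}\right).$$ Definition of $Q(x\mid X^{-t})$: write the chain rule expansion $Q(x^n)=\prod_{0\le t<n}Q(x_t\mid x^t)$, where $Q(x_t\mid x^t)$ is the conditional probability mass function, under the model $Q$ on $\mathcal X^n$, of the coordinate $x_t$ given $x^t=(x_0,\ldots,x_{t-1})$ (an arbitrary probability mass function if $x^t$ has probability zero). For $0\le t<n$, $Q(x\mid x^{-t})$ is the shifted copy of this conditional mass function: its value at $x\in\mathcal X$ and $x^{-t}=(x_{-t},\ldots,x_{-1})$ is the conditional probability under $Q$ that the coordinate with index $t$ equals $x$ given that the coordinates with indices $0,\ldots,t-1$ equal $x_{-t},\ldots,x_{-1}$. In the formula for $\hat P(x\mid X^{-n})$ these conditional mass functions are those of the model $Q$ on $\mathcal X^n$ (if the models are not marginals of one probability measure they may depend on $n$). *)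

theory Defs
  imports "HOL-Probability.Probability"
begin

abbreviation path_space :: "(int \<Rightarrow> 'a) measure" where
  "path_space \<equiv> (\<Pi>\<^sub>M i\<in>UNIV. count_space UNIV)"

definition shift :: "(int \<Rightarrow> 'a) \<Rightarrow> int \<Rightarrow> 'a" where
  "shift \<omega> = (\<lambda>i. \<omega> (i + 1))"

definition stationary :: "(int \<Rightarrow> 'a) measure \<Rightarrow> bool" where
  "stationary P \<longleftrightarrow>
     prob_space P \<and> sets P = sets path_space \<and> distr P path_space shift = P"

text \<open>The words \<open>(X\<^sub>0, \<dots>, X\<^sub>n\<^sub>-\<^sub>1)\<close> and \<open>(X\<^sub>-\<^sub>t, \<dots>, X\<^sub>-\<^sub>1)\<close>, in this order.\<close>

definition block :: "nat \<Rightarrow> (int \<Rightarrow> 'a) \<Rightarrow> 'a list" where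
  "block n \<omega> = map (\<lambda>i. \<omega> (int i)) [0..<n]"

definition past :: "nat \<Rightarrow> (int \<Rightarrow> 'a) \<Rightarrow> 'a list" where
  "past t \<omega> = map (\<lambda>i. \<omega> (int i - int t)) [0..<t]"

definition block_mass :: "(int \<Rightarrow> 'a) measure \<Rightarrow> nat \<Rightarrow> 'a list \<Rightarrow> real" where
  "block_mass P n xs = \<P>(\<omega> in P. block n \<omega> = xs)"

text \<open>
  The base-2 logarithm of \<open>p / q\<close>, with value \<open>\<infinity>\<close> where \<open>p\<close> is not dominated by \<open>q\<close>. The
  value at \<open>p = 0\<close> never matters: it occurs only multiplied by \<open>p\<close> or on a null set.
\<close>

definition log_ratio :: "real \<Rightarrow> real \<Rightarrow> ereal" where
  "log_ratio p q = (if p \<noteq> 0 \<and> q = 0 then \<infinity> else ereal (log 2 (p / q)))"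

text \<open>
  Information divergence of mass functions. The library's \<open>KL_divergence\<close> is real-valued
  and so cannot express the value \<open>\<infinity>\<close>.
\<close>

definition info_div :: "'b set \<Rightarrow> ('b \<Rightarrow> real) \<Rightarrow> ('b \<Rightarrow> real) \<Rightarrow> ereal" where
  "info_div A p q = (\<Sum>x\<in>A. ereal (p x) * log_ratio (p x) (q x))"

text \<open>The two ways in which the models \<open>Q\<close> may be good for \<open>P\<close>.\<close>

definition divergence_rate_vanishes ::
    "(int \<Rightarrow> 'a) measure \<Rightarrow> (nat \<Rightarrow> 'a list pmf) \<Rightarrow> bool" where
  "divergence_rate_vanishes P Q \<longleftrightarrow>
     (\<lambda>n. info_div {xs. length xs = n} (block_mass P n) (pmf (Q n)) / ereal (real n))
       \<longlonglongrightarrow> 0"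

definition log_ratio_rate_vanishes_L1 ::
    "(int \<Rightarrow> 'a) measure \<Rightarrow> (nat \<Rightarrow> 'a list pmf) \<Rightarrow> bool" where
  "log_ratio_rate_vanishes_L1 P Q \<longleftrightarrow>
     (\<lambda>n. \<integral>\<^sup>+ \<omega>. e2ennreal \<bar>log_ratio (block_mass P n (block n \<omega>)) (pmf (Q n) (block n \<omega>))
                            / ereal (real n)\<bar> \<partial>P)
       \<longlonglongrightarrow> 0"

text \<open>
  \<open>K n ys\<close> is the conditional mass function under \<open>Q n\<close> of the coordinate with index
  \<open>length ys\<close>, given that the preceding coordinates are \<open>ys\<close>; it is an arbitrary mass
  function if the word \<open>ys\<close> has probability zero under \<open>Q n\<close>.
\<close>

definition conditionals_of :: "(nat \<Rightarrow> 'a list pmf) \<Rightarrow> (nat \<Rightarrow> 'a list \<Rightarrow> 'a pmf) \<Rightarrow> bool" where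
  "conditionals_of Q K \<longleftrightarrow>
     (\<forall>n t ys x. t < n \<longrightarrow> length ys = t \<longrightarrow> \<P>(zs in Q n. take t zs = ys) > 0 \<longrightarrow>
        pmf (K n ys) x = \<P>(zs in Q n. zs ! t = x \<bar> take t zs = ys))"

definition estimate ::
    "(nat \<Rightarrow> 'a list \<Rightarrow> 'a pmf) \<Rightarrow> nat \<Rightarrow> (int \<Rightarrow> 'a) \<Rightarrow> 'a \<Rightarrow> real" where
  "estimate K n \<omega> x = (\<Sum>t<n. pmf (K n (past t \<omega>)) x) / real n"

text \<open>The sigma-algebra generated by \<open>X\<^sub>i\<close>, \<open>i < 0\<close>.\<close>

definition past_algebra :: "(int \<Rightarrow> 'a) measure" where
  "past_algebra =
     vimage_algebra UNIV (\<lambda>\<omega>. restrict \<omega> {..<0}) (\<Pi>\<^sub>M i\<in>{..<0}. count_space UNIV)"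

lemma subalgebra_past_algebra:
  assumes "stationary P"
  shows "subalgebra P past_algebra"
proof -
  have sets: "sets P = sets path_space"
    using assms by (simp add: stationary_def)
  have sp: "space P = UNIV"
    using sets_eq_imp_space_eq[OF sets] by (simp add: space_PiM)
  have "(\<lambda>\<omega>. restrict \<omega> {..<0}) \<in> measurable P (\<Pi>\<^sub>M i\<in>{..<0}. count_space (UNIV :: 'a set))"
    unfolding measurable_cong_sets[OF sets refl]
    by (rule measurable_restrict_subset) simp
  then have "sets past_algebra \<subseteq> sets P"
    unfolding past_algebra_def sp[symmetric] by (rule sets_image_in_sets[OF refl])
  then show ?thesis
    by (simp add: subalgebra_def sp past_algebra_def)
qed

text \<open>A version of \<open>P(x | X\<^sup>-)\<close>; it is a mass function in \<open>x\<close> almost surely.\<close>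

definition cond_mass :: "(int \<Rightarrow> 'a) measure \<Rightarrow> (int \<Rightarrow> 'a) \<Rightarrow> 'a \<Rightarrow> real" where
  "cond_mass P \<omega> x = real_cond_exp P past_algebra (indicator {\<omega>'. \<omega>' 0 = x}) \<omega>"

text \<open>
  Since the divergence is almost surely nonnegative, the truncation of negative values by
  \<open>e2ennreal\<close> only has an effect on a null set.
\<close>

definition expected_divergence ::
    "(int \<Rightarrow> 'a) measure \<Rightarrow> ((int \<Rightarrow> 'a) \<Rightarrow> 'a \<Rightarrow> real) \<Rightarrow> ennreal" where
  "expected_divergence P p =
     (\<integral>\<^sup>+ \<omega>. e2ennreal (info_div UNIV (cond_mass P \<omega>) (p \<omega>)) \<partial>P)"

end

theory Submission
  imports Defs "HOL-Real_Asymp.Real_Asymp"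
begin

text \<open>
  Write \<open>g x = P(x | X\<^sup>-)\<close> and \<open>q\<^sub>t x = Q(x | X\<^sup>-\<^sup>t)\<close>. The estimate is the average of the
  \<open>q\<^sub>t\<close>, \<open>t < n\<close>, so by concavity of the logarithm its divergence from \<open>g\<close> is at most the average
  of the divergences of the single \<open>q\<^sub>t\<close> (\<open>info_div_mixture_le\<close>). The expectation of that
  average can be computed. The expectation of \<open>\<Sum>x. g x * log (q\<^sub>t x)\<close> is that of
  \<open>log Q(X\<^sub>0 | X\<^sup>-\<^sup>t)\<close>, which by stationarity is that of \<open>log Q(X\<^sub>t | X\<^sup>t)\<close>, and the chain rule
  sums these to the expectation of \<open>log Q(X\<^sup>n)\<close>. Treating the conditional masses of \<open>P\<close> itself
  in the same way gives (\<open>expected_divergence_le\<close>)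

    \<open>E I(P(.|X\<^sup>-) | estimate)  \<le>  I(P\<^sub>n | Q\<^sub>n) / n + (1/n) * (\<Sum>t<n. H(X | X\<^sup>-\<^sup>t) - H(X | X\<^sup>-))\<close>,

  where \<open>I(P\<^sub>n | Q\<^sub>n)\<close> is the divergence of the laws of \<open>X\<^sup>n\<close>. The first term tends to 0 by either
  assumption on the models. The second is a Cesaro mean of entropy differences, so it remains to
  show that \<open>H(X | X\<^sup>-\<^sup>t)\<close> tends to \<open>H(X | X\<^sup>-)\<close> (\<open>entropy_gap_tendsto_0\<close>).

  For this, convergence in \<open>L\<^sup>1\<close> of the conditional masses given \<open>X\<^sup>-\<^sup>t\<close> to those given \<open>X\<^sup>-\<close> is
  enough, because \<open>u * log u\<close> is uniformly continuous on the unit interval. The \<open>L\<^sup>1\<close> convergence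
  (\<open>word_cond_tendsto_cond_mass\<close>) holds because functions of finitely many past coordinates are
  dense among the integrable functions of the whole past, and conditioning on \<open>X\<^sup>-\<^sup>t\<close> contracts
  the \<open>L\<^sup>1\<close> distance; no almost sure martingale convergence is involved.
\<close>

section \<open>Logarithms, divergences and averages\<close>

lemma mean_log_le_log_mean:
  fixes q :: "nat \<Rightarrow> real"
  assumes "0 < n" and pos: "\<And>t. t < n \<Longrightarrow> 0 < q t"
  shows "(\<Sum>t<n. log 2 (q t)) / real n \<le> log 2 ((\<Sum>t<n. q t) / real n)"
proof -
  have "- log 2 (\<Sum>t<n. (1 / real n) *\<^sub>R q t) \<le> (\<Sum>t<n. (1 / real n) * - log 2 (q t))"
    by (rule convex_on_sum[OF _ _ minus_log_convex]) (use assms in auto)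
  then show ?thesis
    by (simp add: sum_negf flip: sum_divide_distrib)
qed

lemma Gibbs_inequality:
  fixes p q :: "'b \<Rightarrow> real"
  assumes "finite A" and p: "\<And>x. x \<in> A \<Longrightarrow> 0 \<le> p x" "sum p A = 1"
    and q: "\<And>x. x \<in> A \<Longrightarrow> 0 \<le> q x" "sum q A = 1"
    and dom: "\<And>x. x \<in> A \<Longrightarrow> p x \<noteq> 0 \<Longrightarrow> 0 < q x"
  shows "(\<Sum>x\<in>A. p x * log 2 (q x)) \<le> (\<Sum>x\<in>A. p x * log 2 (p x))"
proof -
  have "p x * (ln (q x) - ln (p x)) \<le> q x - p x" if x: "x \<in> A" for x
  proof (cases "p x = 0")
    case False
    then have pos: "0 < p x" "0 < q x"
      using x p dom by (auto simp: less_le)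
    then have "p x * ln (q x / p x) \<le> p x * (q x / p x - 1)"
      by (intro mult_left_mono ln_le_minus_one) auto
    also have "\<dots> = q x - p x"
      using pos by (simp add: right_diff_distrib)
    finally show ?thesis
      using pos by (simp add: ln_div)
  qed (use q x in auto)
  then have "(\<Sum>x\<in>A. p x * (ln (q x) - ln (p x))) \<le> (\<Sum>x\<in>A. q x - p x)"
    by (rule sum_mono)
  also have "\<dots> = 0"
    by (simp add: sum_subtractf p q)
  finally have "(\<Sum>x\<in>A. p x * ln (q x)) \<le> (\<Sum>x\<in>A. p x * ln (p x))"
    by (simp add: algebra_simps sum_subtractf)
  then show ?thesis
    by (simp add: log_def divide_right_mono flip: sum_divide_distrib)
qed

lemma info_div_eq_ereal:
  assumes "\<And>x. x \<in> A \<Longrightarrow> p x \<noteq> 0 \<Longrightarrow> q x \<noteq> 0"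
  shows "info_div A p q = ereal (\<Sum>x\<in>A. p x * log 2 (p x / q x))"
proof -
  have "ereal (p x) * log_ratio (p x) (q x) = ereal (p x * log 2 (p x / q x))" if "x \<in> A" for x
    using assms[OF that] by (auto simp: log_ratio_def)
  then show ?thesis
    unfolding info_div_def by simp
qed

text \<open>
  \<open>Y\<close> is the average over \<open>t\<close> of the divergences of \<open>p\<close> from \<open>q t\<close>, arranged so that the entropy
  of \<open>p\<close> occurs once. The inequality is Jensen's; the nonnegativity is Gibbs' inequality, and
  ensures that nothing is lost when \<open>Y\<close> is converted to an extended nonnegative number.
\<close>
lemma info_div_mixture_le:
  fixes p :: "'a::finite \<Rightarrow> real" and q :: "nat \<Rightarrow> 'a \<Rightarrow> real"
  assumes "0 < n" and p: "\<And>x. 0 \<le> p x" "(\<Sum>x\<in>UNIV. p x) = 1"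
    and q: "\<And>t x. 0 \<le> q t x" "\<And>t. (\<Sum>x\<in>UNIV. q t x) = 1"
    and dom: "\<And>t x. t < n \<Longrightarrow> p x \<noteq> 0 \<Longrightarrow> 0 < q t x"
  defines "Y \<equiv> (\<Sum>x\<in>UNIV. p x * log 2 (p x)) - (\<Sum>t<n. \<Sum>x\<in>UNIV. p x * log 2 (q t x)) / real n"
  shows "info_div UNIV p (\<lambda>x. (\<Sum>t<n. q t x) / real n) \<le> ereal Y" and "0 \<le> Y"
proof -
  let ?m = "\<lambda>x. (\<Sum>t<n. q t x) / real n"
  have pos: "0 < ?m x" if "p x \<noteq> 0" for x
    using that \<open>0 < n\<close> by (intro divide_pos_pos sum_pos) (auto intro: dom)
  have term_le: "p x * log 2 (p x / ?m x)
      \<le> p x * log 2 (p x) - (\<Sum>t<n. p x * log 2 (q t x)) / real n" for x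
  proof (cases "p x = 0")
    case False
    have "log 2 (p x / ?m x) = log 2 (p x) - log 2 (?m x)"
      using p(1)[of x] False pos[OF False] by (intro log_divide_pos) linarith+
    also have "\<dots> \<le> log 2 (p x) - (\<Sum>t<n. log 2 (q t x)) / real n"
      using mean_log_le_log_mean[of n "\<lambda>t. q t x"] \<open>0 < n\<close> dom[OF _ False] by simp
    finally have "p x * log 2 (p x / ?m x)
        \<le> p x * (log 2 (p x) - (\<Sum>t<n. log 2 (q t x)) / real n)"
      by (intro mult_left_mono p)
    then show ?thesis
      by (simp add: right_diff_distrib sum_distrib_left)
  qed simp
  have "(\<Sum>x\<in>UNIV. p x * log 2 (p x / ?m x))
      \<le> (\<Sum>x\<in>UNIV. p x * log 2 (p x) - (\<Sum>t<n. p x * log 2 (q t x)) / real n)"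
    by (rule sum_mono) (rule term_le)
  also have "\<dots> = Y"
    unfolding Y_def sum_subtractf sum_divide_distrib[symmetric] by (subst sum.swap) (rule refl)
  finally show "info_div UNIV p ?m \<le> ereal Y"
    using pos by (subst info_div_eq_ereal) force+
  have "(\<Sum>t<n. \<Sum>x\<in>UNIV. p x * log 2 (q t x)) \<le> (\<Sum>t<n. \<Sum>x\<in>UNIV. p x * log 2 (p x))"
    by (intro sum_mono Gibbs_inequality) (auto intro: p q dom)
  then have "(\<Sum>t<n. \<Sum>x\<in>UNIV. p x * log 2 (q t x)) / real n \<le> (\<Sum>x\<in>UNIV. p x * log 2 (p x))"
    using \<open>0 < n\<close> by (simp add: divide_le_eq mult.commute)
  then show "0 \<le> Y"
    by (simp add: Y_def)
qed

lemma continuous_on_xlogx: "continuous_on {0..1} (\<lambda>u::real. u * log 2 u)"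
proof -
  have lim: "((\<lambda>u::real. u * log 2 u) \<longlongrightarrow> 0) (at_right 0)"
    by real_asymp
  have "continuous (at u within {0..1}) (\<lambda>u::real. u * log 2 u)" if "u \<in> {0..1}" for u
  proof (cases "u = 0")
    case True
    have "((\<lambda>u::real. u * log 2 u) \<longlongrightarrow> 0) (at 0 within {0..1})"
      by (rule tendsto_mono[OF _ lim], unfold at_within_def, rule inf_mono) auto
    then show ?thesis
      using True by (simp add: continuous_within)
  next
    case False
    then show ?thesis
      using that by (intro continuous_intros) auto
  qed
  then show ?thesis
    by (simp add: continuous_on_eq_continuous_within)
qed

text \<open>
  The function \<open>u * log u\<close> has infinite slope at 0, hence the additive \<open>\<epsilon>\<close>: uniform continuity
  handles close arguments, and boundedness handles those at distance at least \<open>\<delta>\<close>. A bound that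
  is linear in \<open>\<bar>u - v\<bar>\<close> is what \<open>L\<^sup>1\<close> convergence can be inserted into.
\<close>
lemma xlogx_approx_Lipschitz:
  assumes "0 < \<epsilon>"
  obtains C where "0 \<le> C" "\<And>u v. u \<in> {0..1} \<Longrightarrow> v \<in> {0..1} \<Longrightarrow>
    \<bar>u * log 2 u - v * log 2 v\<bar> \<le> \<epsilon> + C * \<bar>u - v\<bar>"
proof -
  let ?\<phi> = "\<lambda>u::real. u * log 2 u"
  have "uniformly_continuous_on {0..1} ?\<phi>"
    by (intro compact_uniformly_continuous continuous_on_xlogx) simp
  then obtain \<delta> where \<delta>: "0 < \<delta>"
    "\<And>u v. u \<in> {0..1} \<Longrightarrow> v \<in> {0..1} \<Longrightarrow> dist v u < \<delta> \<Longrightarrow> dist (?\<phi> v) (?\<phi> u) < \<epsilon>"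
    using assms unfolding uniformly_continuous_on_def by meson
  have "bounded (?\<phi> ` {0..1})"
    by (intro compact_imp_bounded compact_continuous_image continuous_on_xlogx) simp
  then obtain B where "\<forall>y \<in> ?\<phi> ` {0..1}. norm y \<le> B"
    unfolding bounded_iff by blast
  then have B: "\<bar>?\<phi> u\<bar> \<le> B" if "u \<in> {0..1}" for u
    using that by fastforce
  have B0: "0 \<le> B"
    using B[of 0] by simp
  show thesis
  proof (rule that)
    show "0 \<le> 2 * B / \<delta>"
      using B0 \<delta> by simp
    fix u v :: real assume uv: "u \<in> {0..1}" "v \<in> {0..1}"
    show "\<bar>?\<phi> u - ?\<phi> v\<bar> \<le> \<epsilon> + 2 * B / \<delta> * \<bar>u - v\<bar>"
    proof (cases "\<bar>u - v\<bar> < \<delta>")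
      case True
      then have "\<bar>?\<phi> u - ?\<phi> v\<bar> < \<epsilon>"
        using \<delta>(2)[OF uv(2,1)] by (simp add: dist_real_def)
      moreover have "0 \<le> 2 * B / \<delta> * \<bar>u - v\<bar>"
        using B0 \<delta> by simp
      ultimately show ?thesis by simp
    next
      case False
      have "\<bar>?\<phi> u - ?\<phi> v\<bar> \<le> 2 * B"
        using B[OF uv(1)] B[OF uv(2)] by simp
      also have "\<dots> = 2 * B / \<delta> * \<delta>"
        using \<delta> by simp
      also have "\<dots> \<le> 2 * B / \<delta> * \<bar>u - v\<bar>"
        using False B0 \<delta> by (intro mult_left_mono) auto
      finally show ?thesis
        using assms by simp
    qed
  qed
qed

lemma Cesaro_mean_tendsto_0:
  fixes a :: "nat \<Rightarrow> real"
  assumes "a \<longlonglongrightarrow> 0"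
  shows "(\<lambda>n. (\<Sum>t<n. a t) / real n) \<longlonglongrightarrow> 0"
proof (rule LIMSEQ_I)
  fix \<epsilon> :: real assume \<epsilon>: "0 < \<epsilon>"
  obtain m where m: "\<And>t. t \<ge> m \<Longrightarrow> \<bar>a t\<bar> < \<epsilon> / 2"
    using LIMSEQ_D[OF assms, of "\<epsilon> / 2"] \<epsilon> by auto
  define S where "S = (\<Sum>t<m. \<bar>a t\<bar>)"
  obtain k :: nat where k: "2 * S / \<epsilon> < real k"
    using reals_Archimedean2 by blast
  have "norm ((\<Sum>t<n. a t) / real n - 0) < \<epsilon>" if n: "n \<ge> max (Suc m) k" for n
  proof -
    have "\<bar>\<Sum>t<n. a t\<bar> \<le> (\<Sum>t<n. \<bar>a t\<bar>)"
      by (rule sum_abs)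
    also have "\<dots> = S + (\<Sum>t\<in>{m..<n}. \<bar>a t\<bar>)"
      unfolding S_def using n sum.atLeastLessThan_concat[of 0 m n "\<lambda>t. \<bar>a t\<bar>"]
      by (simp add: atLeast0LessThan)
    also have "(\<Sum>t\<in>{m..<n}. \<bar>a t\<bar>) \<le> (\<Sum>t\<in>{m..<n}. \<epsilon> / 2)"
      by (rule sum_mono) (use m in \<open>auto intro: less_imp_le\<close>)
    also have "\<dots> \<le> real n * (\<epsilon> / 2)"
      using \<epsilon> by (simp add: mult_right_mono)
    also have "S + real n * (\<epsilon> / 2) < real n * \<epsilon>"
    proof -
      have "2 * S < real k * \<epsilon>"
        using k \<epsilon> by (simp add: field_simps)
      also have "\<dots> \<le> real n * \<epsilon>"
        using n \<epsilon> by (intro mult_right_mono) auto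
      finally show ?thesis by simp
    qed
    finally show ?thesis
      using n by (simp add: field_simps)
  qed
  then show "\<exists>N. \<forall>n\<ge>N. norm ((\<Sum>t<n. a t) / real n - 0) < \<epsilon>"
    by blast
qed

section \<open>Words of a stationary process\<close>

lemma measurable_map_coords:
  assumes "\<And>j. j \<in> set js \<Longrightarrow> (\<lambda>\<omega>. \<omega> (f j)) \<in> M \<rightarrow>\<^sub>M count_space (UNIV :: 'a::finite set)"
  shows "(\<lambda>\<omega>. map (\<lambda>j. \<omega> (f j)) js) \<in> M \<rightarrow>\<^sub>M count_space UNIV"
  using assms
proof (induction js)
  case (Cons j js)
  have tail: "(\<lambda>\<omega>. map (\<lambda>j. \<omega> (f j)) js) \<in> M \<rightarrow>\<^sub>M count_space UNIV"
    using Cons by simp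
  have cons: "(\<lambda>\<omega>. a # map (\<lambda>j. \<omega> (f j)) js) \<in> M \<rightarrow>\<^sub>M count_space UNIV" for a
    by (rule measurable_compose[OF tail]) simp
  have hd: "(\<lambda>\<omega>. \<omega> (f j)) \<in> M \<rightarrow>\<^sub>M count_space UNIV"
    using Cons by simp
  have "(\<lambda>\<omega>. (\<lambda>a \<omega>. a # map (\<lambda>j. \<omega> (f j)) js) (\<omega> (f j)) \<omega>) \<in> M \<rightarrow>\<^sub>M count_space UNIV"
    by (rule measurable_compose_countable'[OF cons hd]) (rule countable_finite, simp)
  then show ?case by simp
qed simp

lemma length_block [simp]: "length (block n \<omega>) = n"
  and length_past [simp]: "length (past n \<omega>) = n"
  by (simp_all add: block_def past_def)

lemma block_Suc: "block (Suc n) \<omega> = block n \<omega> @ [\<omega> (int n)]"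
  by (simp add: block_def)

lemma take_block: "t \<le> n \<Longrightarrow> take t (block n \<omega>) = block t \<omega>"
  by (simp add: block_def take_map)

lemma nth_block: "t < n \<Longrightarrow> block n \<omega> ! t = \<omega> (int t)"
  by (simp add: block_def)

lemma past_shift: "past t (\<lambda>i. \<omega> (i + int t)) = block t \<omega>"
  by (simp add: block_def past_def)

lemma past_eq_drop: "t \<le> t' \<Longrightarrow> past t \<omega> = drop (t' - t) (past t' \<omega>)"
  by (rule nth_equalityI) (auto simp: past_def algebra_simps of_nat_diff)

lemma measurable_coord_past_algebra:
  assumes "i < 0"
  shows "(\<lambda>\<omega>. \<omega> i) \<in> past_algebra \<rightarrow>\<^sub>M count_space UNIV"
proof -
  have "(\<lambda>\<omega>. restrict \<omega> {..<0}) \<in> past_algebra \<rightarrow>\<^sub>M (\<Pi>\<^sub>M i\<in>{..<0}. count_space UNIV)"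
    unfolding past_algebra_def
    by (rule measurable_vimage_algebra1) (auto simp: space_PiM)
  moreover have "(\<lambda>\<omega>. \<omega> i) \<in> (\<Pi>\<^sub>M i\<in>{..<0::int}. count_space UNIV) \<rightarrow>\<^sub>M count_space UNIV"
    using assms by (intro measurable_component_singleton) auto
  ultimately have "(\<lambda>\<omega>. (restrict \<omega> {..<0}) i) \<in> past_algebra \<rightarrow>\<^sub>M count_space UNIV"
    by (rule measurable_compose)
  then show ?thesis
    using assms by simp
qed

lemma measurable_past_algebra_past:
  "past t \<in> past_algebra \<rightarrow>\<^sub>M count_space (UNIV :: 'a::finite list set)"
  unfolding past_def[abs_def]
  by (rule measurable_map_coords) (auto intro: measurable_coord_past_algebra)

text \<open>
  Cylinder events form a generator that is stable under intersection, which is what an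
  approximation of past events by finite words has to start from.
\<close>

lemma past_algebra_subset_cylinders:
  "sets (past_algebra :: (int \<Rightarrow> 'a::finite) measure) \<subseteq> sigma_sets UNIV {past t -` B | t B. True}"
proof -
  let ?G = "{past t -` B | t (B :: 'a list set). True}"
  let ?N = "sigma UNIV ?G :: (int \<Rightarrow> 'a) measure"
  have coord: "(\<lambda>\<omega>. \<omega> i) \<in> ?N \<rightarrow>\<^sub>M count_space UNIV" if "i < 0" for i
  proof (rule measurableI)
    fix A :: "'a set"
    have "past (nat (- i)) -` {ys. ys ! 0 \<in> A} = (\<lambda>\<omega>. \<omega> i) -` A"
      using that by (auto simp: past_def)
    then have "(\<lambda>\<omega>. \<omega> i) -` A \<in> ?G"
      by blast
    then show "(\<lambda>\<omega>. \<omega> i) -` A \<inter> space ?N \<in> sets ?N"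
      by (auto simp: space_measure_of_conv)
  qed auto
  have "(\<lambda>\<omega>. restrict \<omega> {..<0}) \<in> ?N \<rightarrow>\<^sub>M (\<Pi>\<^sub>M i\<in>{..<0}. count_space UNIV)"
    using coord by (intro measurable_restrict) simp
  then have "sets past_algebra \<subseteq> sets ?N"
    unfolding past_algebra_def
    by (intro sets_image_in_sets) (auto simp: space_measure_of_conv)
  then show ?thesis
    by simp
qed

lemma Int_stable_cylinders: "Int_stable {past t -` B | t (B :: 'a list set). True}"
unfolding Int_stable_def
proof (intro ballI)
  fix E F assume "E \<in> {past t -` B | t (B :: 'a list set). True}"
    and "F \<in> {past t -` B | t (B :: 'a list set). True}"
  then obtain s B t C where EF: "E = past s -` B" "F = past t -` C"
    by blast
  have "E \<inter> F = past (max s t) -` {ys. drop (max s t - s) ys \<in> B \<and> drop (max s t - t) ys \<in> C}"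
    unfolding EF by (auto simp flip: past_eq_drop)
  then show "E \<inter> F \<in> {past t -` B | t (B :: 'a list set). True}"
    by blast
qed

locale stationary_process =
  fixes P :: "(int \<Rightarrow> 'a::finite) measure"
  assumes stationary: "stationary P"

sublocale stationary_process \<subseteq> prob_space P
  using stationary by (simp add: stationary_def)

sublocale stationary_process \<subseteq> finite_measure_subalgebra P past_algebra
  by standard (rule subalgebra_past_algebra[OF stationary])

context stationary_process
begin

lemma sets_P: "sets P = sets path_space"
  using stationary by (simp add: stationary_def)

lemma space_P [simp]: "space P = UNIV"
  using sets_eq_imp_space_eq[OF sets_P] by (simp add: space_PiM)

lemma measurable_coord [measurable]: "(\<lambda>\<omega>. \<omega> i) \<in> P \<rightarrow>\<^sub>M count_space UNIV"
  unfolding measurable_cong_sets[OF sets_P refl]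
  by (rule measurable_component_singleton) simp

lemma measurable_block [measurable]: "block n \<in> P \<rightarrow>\<^sub>M count_space UNIV"
  unfolding block_def[abs_def] by (rule measurable_map_coords) measurable

lemma measurable_past [measurable]: "past n \<in> P \<rightarrow>\<^sub>M count_space UNIV"
  unfolding past_def[abs_def] by (rule measurable_map_coords) measurable

lemma distr_shift: "distr P path_space (\<lambda>\<omega> i. \<omega> (i + int k)) = P"
proof (induction k)
  case 0
  show ?case
    by (simp add: distr_id2 sets_P)
next
  case (Suc k)
  have shift: "distr P path_space shift = P"
    using stationary by (simp add: stationary_def)
  have m: "(\<lambda>\<omega> i. \<omega> (i + int k)) \<in> path_space \<rightarrow>\<^sub>M (path_space :: (int \<Rightarrow> 'a) measure)"
    by (rule measurable_PiM_single') (simp_all add: space_PiM measurable_component_singleton)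
  have s: "shift \<in> P \<rightarrow>\<^sub>M (path_space :: (int \<Rightarrow> 'a) measure)"
    unfolding shift_def[abs_def] by (rule measurable_PiM_single') (simp_all add: measurable_coord)
  have "distr P path_space (\<lambda>\<omega> i. \<omega> (i + int (Suc k)))
      = distr P path_space ((\<lambda>\<omega> i. \<omega> (i + int k)) \<circ> shift)"
    by (simp add: o_def shift_def ac_simps)
  also have "\<dots> = distr (distr P path_space shift) path_space (\<lambda>\<omega> i. \<omega> (i + int k))"
    by (rule distr_distr[OF m s, symmetric])
  finally show ?case
    by (simp add: shift Suc)
qed

lemma expectation_shift:
  fixes F :: "(int \<Rightarrow> 'a) \<Rightarrow> real"
  assumes "F \<in> borel_measurable P"
  shows "(\<integral>\<omega>. F (\<lambda>i. \<omega> (i + int k)) \<partial>P) = (\<integral>\<omega>. F \<omega> \<partial>P)"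
proof -
  have m: "(\<lambda>\<omega> i. \<omega> (i + int k)) \<in> P \<rightarrow>\<^sub>M (path_space :: (int \<Rightarrow> 'a) measure)"
    by (rule measurable_PiM_single') (simp_all add: measurable_coord)
  have "(\<integral>\<omega>. F \<omega> \<partial>P) = (\<integral>\<omega>. F \<omega> \<partial>distr P path_space (\<lambda>\<omega> i. \<omega> (i + int k)))"
    by (simp only: distr_shift)
  also have "\<dots> = (\<integral>\<omega>. F (\<lambda>i. \<omega> (i + int k)) \<partial>P)"
    by (rule integral_distr[OF m]) (use assms measurable_cong_sets[OF sets_P refl] in blast)
  finally show ?thesis ..
qed

lemma integrable_finite_range:
  fixes f :: "(int \<Rightarrow> 'a) \<Rightarrow> real"
  assumes "f \<in> borel_measurable P" "finite (range f)"
  shows "integrable P f"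
proof (rule integrable_const_bound)
  have "norm (f \<omega>) \<le> Max (norm ` range f)" for \<omega>
    by (rule Max_ge) (use assms(2) in blast)+
  then show "AE \<omega> in P. norm (f \<omega>) \<le> Max (norm ` range f)"
    by simp
qed (rule assms)

lemma measurable_past_fun [measurable]: "(\<lambda>\<omega>. h (past t \<omega>)) \<in> borel_measurable P"
  by (rule measurable_compose[OF measurable_past]) simp

lemma measurable_block_fun [measurable]: "(\<lambda>\<omega>. h (block t \<omega>)) \<in> borel_measurable P"
  by (rule measurable_compose[OF measurable_block]) simp

lemma measurable_past_coord_fun: "(\<lambda>\<omega>. F (past t \<omega>) (\<omega> 0)) \<in> borel_measurable P"
  by (rule measurable_compose_countable'[OF measurable_past_fun measurable_coord])
    (rule countable_finite, simp)

lemma integrable_past [simp, intro]: "integrable P (\<lambda>\<omega>. h (past t \<omega>) :: real)"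
proof (rule integrable_finite_range)
  have "range (\<lambda>\<omega>. h (past t \<omega>)) \<subseteq> h ` {ys. set ys \<subseteq> UNIV \<and> length ys = t}"
    by auto
  then show "finite (range (\<lambda>\<omega>. h (past t \<omega>)))"
    by (rule finite_subset) (intro finite_imageI finite_lists_length_eq finite)
qed (rule measurable_past_fun)

lemma integrable_block [simp, intro]: "integrable P (\<lambda>\<omega>. h (block t \<omega>) :: real)"
proof (rule integrable_finite_range)
  have "range (\<lambda>\<omega>. h (block t \<omega>)) \<subseteq> h ` {ys. set ys \<subseteq> UNIV \<and> length ys = t}"
    by auto
  then show "finite (range (\<lambda>\<omega>. h (block t \<omega>)))"
    by (rule finite_subset) (intro finite_imageI finite_lists_length_eq finite)
qed (rule measurable_block_fun)

lemma integrable_block_coord: "integrable P (\<lambda>\<omega>. F (block t \<omega>) (\<omega> (int t)) :: real)"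
  using integrable_block[of "\<lambda>zs. F (butlast zs) (last zs)" "Suc t"] by (simp add: block_Suc)

lemma integrable_past_times_coord:
  "integrable P (\<lambda>\<omega>. h (past t \<omega>) * indicator {\<omega>'. \<omega>' 0 = x} \<omega> :: real)"
  by (rule integrable_real_mult_indicator) (use measurable_sets[OF measurable_coord, of "{x}" 0] in
      \<open>auto simp: vimage_def\<close>)

text \<open>The shift by \<open>t\<close> carries the pair \<open>(X\<^sup>-\<^sup>t, X\<^sub>0)\<close> to \<open>(X\<^sup>t, X\<^sub>t)\<close>.\<close>
lemma expectation_past_coord:
  "(\<integral>\<omega>. F (past t \<omega>) (\<omega> 0) \<partial>P) = (\<integral>\<omega>. F (block t \<omega>) (\<omega> (int t)) \<partial>P :: real)"
  using expectation_shift[OF measurable_past_coord_fun[of F t], of t] by (simp add: past_shift)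

lemma block_event [measurable]: "{\<omega>. block n \<omega> = xs} \<in> sets P"
  using measurable_sets[OF measurable_block, of "{xs}" n] by (simp add: vimage_def)

lemma block_mass_eq: "block_mass P n xs = measure P {\<omega>. block n \<omega> = xs}"
  by (simp add: block_mass_def)

lemma finite_words [simp]: "finite {xs :: 'a list. length xs = n}"
  using finite_lists_length_eq[OF finite, of "UNIV :: 'a set" n] by simp

lemma expectation_sum_indicator:
  fixes c :: "'i \<Rightarrow> real"
  assumes "\<And>i. i \<in> I \<Longrightarrow> E i \<in> sets P"
  shows "(\<integral>\<omega>. (\<Sum>i\<in>I. c i * indicator (E i) \<omega>) \<partial>P) = (\<Sum>i\<in>I. c i * measure P (E i))"
proof -
  have int: "integrable P (\<lambda>\<omega>. c i * indicator (E i) \<omega>)" if "i \<in> I" for i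
    using assms[OF that] by (intro integrable_mult_right integrable_real_indicator)
      (simp_all add: less_top[symmetric])
  have "(\<integral>\<omega>. (\<Sum>i\<in>I. c i * indicator (E i) \<omega>) \<partial>P) = (\<Sum>i\<in>I. \<integral>\<omega>. c i * indicator (E i) \<omega> \<partial>P)"
    by (rule Bochner_Integration.integral_sum) (rule int)
  also have "\<dots> = (\<Sum>i\<in>I. c i * measure P (E i))"
    by (rule sum.cong[OF refl]) simp
  finally show ?thesis .
qed

lemma expectation_block:
  "(\<integral>\<omega>. h (block n \<omega>) \<partial>P) = (\<Sum>xs\<in>{xs. length xs = n}. block_mass P n xs * h xs :: real)"
proof -
  let ?W = "{xs :: 'a list. length xs = n}"
  have "(\<Sum>xs\<in>?W. h xs * indicator {\<omega>. block n \<omega> = xs} \<omega>) = h (block n \<omega>)" for \<omega>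
    by (subst sum.remove[of _ "block n \<omega>"]) (auto intro!: sum.neutral)
  then have "(\<integral>\<omega>. h (block n \<omega>) \<partial>P)
      = (\<integral>\<omega>. (\<Sum>xs\<in>?W. h xs * indicator {\<omega>. block n \<omega> = xs} \<omega>) \<partial>P)"
    by (simp only:)
  also have "\<dots> = (\<Sum>xs\<in>?W. h xs * block_mass P n xs)"
    unfolding block_mass_eq by (rule expectation_sum_indicator) (rule block_event)
  finally show ?thesis
    by (simp only: mult.commute)
qed

lemma AE_block_mass_pos: "AE \<omega> in P. 0 < block_mass P n (block n \<omega>)"
proof -
  have "AE \<omega> in P. \<forall>xs\<in>{xs. length xs = n}. block n \<omega> = xs \<longrightarrow> block_mass P n xs \<noteq> 0"
  proof (rule AE_finite_allI)
    fix xs :: "'a list"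
    show "AE \<omega> in P. block n \<omega> = xs \<longrightarrow> block_mass P n xs \<noteq> 0"
    proof (cases "block_mass P n xs = 0")
      case True
      then show ?thesis
        using prob_eq_0[OF block_event[of n xs]] by (simp add: block_mass_eq)
    qed simp
  qed simp
  then show ?thesis
    by eventually_elim (simp add: block_mass_eq zero_less_measure_iff)
qed

section \<open>Conditional masses given finite and infinite pasts\<close>

text \<open>
  The conditional mass \<open>P(x | ys)\<close>. On words of probability zero the division by zero makes it the
  zero function rather than a mass function, which is harmless since such words almost surely
  do not occur.
\<close>
definition word_cond :: "'a list \<Rightarrow> 'a \<Rightarrow> real" where
  "word_cond ys x = block_mass P (Suc (length ys)) (ys @ [x]) / block_mass P (length ys) ys"

lemma block_mass_snoc_le: "block_mass P (Suc n) (ys @ [x]) \<le> block_mass P n ys"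
  unfolding block_mass_eq by (rule finite_measure_mono) (auto simp: block_Suc)

lemma block_mass_nonneg [simp]: "0 \<le> block_mass P n xs"
  by (simp add: block_mass_eq)

lemma word_cond_bounds: "word_cond ys x \<in> {0..1}"
  using block_mass_snoc_le[of "length ys" ys x] unfolding word_cond_def
  by (auto simp: divide_le_eq_1 less_le)

text \<open>
  This identity and \<open>expectation_cond_mass\<close> say that \<open>word_cond (past t \<omega>) x\<close> and \<open>cond_mass P \<omega> x\<close> have the same
  integrals against functions of \<open>X\<^sup>-\<^sup>t\<close>, namely those of the event \<open>X\<^sub>0 = x\<close>.
\<close>
lemma expectation_word_cond:
  "(\<integral>\<omega>. f (past t \<omega>) * word_cond (past t \<omega>) x \<partial>P)
    = (\<integral>\<omega>. f (past t \<omega>) * indicator {\<omega>'. \<omega>' 0 = x} \<omega> \<partial>P)"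
proof -
  let ?W = "{ys :: 'a list. length ys = t}"
  have cancel: "block_mass P t ys * (f ys * word_cond ys x)
      = f ys * block_mass P (Suc t) (ys @ [x])" if "ys \<in> ?W" for ys
    using that block_mass_snoc_le[of t ys x] block_mass_nonneg[of "Suc t" "ys @ [x]"]
    by (cases "block_mass P t ys = 0") (simp_all add: word_cond_def)
  have "(\<integral>\<omega>. f (past t \<omega>) * word_cond (past t \<omega>) x \<partial>P)
      = (\<integral>\<omega>. f (block t \<omega>) * word_cond (block t \<omega>) x \<partial>P)"
    by (rule expectation_past_coord[of "\<lambda>ys _. f ys * word_cond ys x"])
  also have "\<dots> = (\<Sum>ys\<in>?W. f ys * block_mass P (Suc t) (ys @ [x]))"
    using cancel by (subst expectation_block[of "\<lambda>ys. f ys * word_cond ys x"]) (rule sum.cong, auto)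
  also have "\<dots> = (\<integral>\<omega>. (\<Sum>ys\<in>?W. f ys * indicator {\<omega>. block (Suc t) \<omega> = ys @ [x]} \<omega>) \<partial>P)"
    unfolding block_mass_eq by (rule expectation_sum_indicator[symmetric]) (rule block_event)
  also have "\<dots> = (\<integral>\<omega>. f (block t \<omega>) * of_bool (\<omega> (int t) = x) \<partial>P)"
  proof (rule Bochner_Integration.integral_cong[OF refl])
    fix \<omega> :: "int \<Rightarrow> 'a"
    show "(\<Sum>ys\<in>?W. f ys * indicator {\<omega>. block (Suc t) \<omega> = ys @ [x]} \<omega>)
        = f (block t \<omega>) * of_bool (\<omega> (int t) = x)"
      by (subst sum.remove[of _ "block t \<omega>"]) (auto simp: block_Suc intro!: sum.neutral)
  qed
  also have "\<dots> = (\<integral>\<omega>. f (past t \<omega>) * of_bool (\<omega> 0 = x) \<partial>P)"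
    by (rule expectation_past_coord[of "\<lambda>ys a. f ys * of_bool (a = x)", symmetric])
  finally show ?thesis
    by (simp add: indicator_def of_bool_def)
qed

lemma measurable_cond_mass [measurable]: "(\<lambda>\<omega>. cond_mass P \<omega> x) \<in> borel_measurable P"
  unfolding cond_mass_def by simp

lemma measurable_past_algebra_cond_mass: "(\<lambda>\<omega>. cond_mass P \<omega> x) \<in> borel_measurable past_algebra"
  unfolding cond_mass_def by simp

lemma measurable_coord_indicator [measurable]:
  "(indicator {\<omega>'. \<omega>' 0 = x} :: (int \<Rightarrow> 'a) \<Rightarrow> real) \<in> borel_measurable P"
  using measurable_sets[OF measurable_coord, of "{x}" 0] by (simp add: vimage_def)

lemma expectation_cond_mass:
  fixes f :: "'a list \<Rightarrow> real"
  shows "integrable P (\<lambda>\<omega>. f (past t \<omega>) * cond_mass P \<omega> x)" (is ?int)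
    and "(\<integral>\<omega>. f (past t \<omega>) * cond_mass P \<omega> x \<partial>P)
      = (\<integral>\<omega>. f (past t \<omega>) * indicator {\<omega>'. \<omega>' 0 = x} \<omega> \<partial>P)" (is ?eq)
proof -
  have "(\<lambda>\<omega>. f (past t \<omega>)) \<in> borel_measurable past_algebra"
    by (rule measurable_compose[OF measurable_past_algebra_past]) simp
  then show ?int ?eq
    unfolding cond_mass_def
    using real_cond_exp_intg[OF integrable_past_times_coord _ measurable_coord_indicator] by auto
qed

text \<open>
  Averaging a function of \<open>X\<^sup>-\<^sup>t\<close> and a symbol over \<open>P(x | X\<^sup>-)\<close> amounts to inserting the actual
  symbol \<open>X\<^sub>0\<close>. With the logarithm of a conditional mass function for \<open>F\<close>, the right-hand side is a
  term of a chain rule.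
\<close>
lemma expectation_cond_mass_sum:
  "(\<integral>\<omega>. (\<Sum>x\<in>UNIV. cond_mass P \<omega> x * F (past t \<omega>) x) \<partial>P)
    = (\<integral>\<omega>. F (block t \<omega>) (\<omega> (int t)) \<partial>P :: real)"
proof -
  have "(\<integral>\<omega>. (\<Sum>x\<in>UNIV. cond_mass P \<omega> x * F (past t \<omega>) x) \<partial>P)
      = (\<Sum>x\<in>UNIV. \<integral>\<omega>. F (past t \<omega>) x * cond_mass P \<omega> x \<partial>P)"
    using expectation_cond_mass(1)[of "\<lambda>ys. F ys _" t]
    by (subst Bochner_Integration.integral_sum) (simp_all add: mult.commute)
  also have "\<dots> = (\<Sum>x\<in>UNIV. \<integral>\<omega>. F (past t \<omega>) x * indicator {\<omega>'. \<omega>' 0 = x} \<omega> \<partial>P)"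
    by (rule sum.cong[OF refl]) (rule expectation_cond_mass(2))
  also have "\<dots> = (\<integral>\<omega>. (\<Sum>x\<in>UNIV. F (past t \<omega>) x * indicator {\<omega>'. \<omega>' 0 = x} \<omega>) \<partial>P)"
    by (rule Bochner_Integration.integral_sum[symmetric]) (rule integrable_past_times_coord)
  also have "\<dots> = (\<integral>\<omega>. F (past t \<omega>) (\<omega> 0) \<partial>P)"
    by (rule Bochner_Integration.integral_cong[OF refl])
      (simp add: indicator_def if_distrib[of "\<lambda>a. _ * a"] cong: if_cong)
  finally show ?thesis
    by (simp add: expectation_past_coord)
qed

lemma AE_cond_mass_pmf: "AE \<omega> in P. (\<forall>x. 0 \<le> cond_mass P \<omega> x) \<and> (\<Sum>x\<in>UNIV. cond_mass P \<omega> x) = 1"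
proof -
  let ?I = "\<lambda>x. indicator {\<omega>'. \<omega>' 0 = x} :: (int \<Rightarrow> 'a) \<Rightarrow> real"
  have int: "integrable P (?I x)" for x
    using integrable_past_times_coord[of "\<lambda>_. 1" 0 x] by simp
  have nonneg: "AE \<omega> in P. \<forall>x\<in>UNIV. 0 \<le> cond_mass P \<omega> x"
    unfolding cond_mass_def by (intro AE_finite_allI real_cond_exp_pos) auto
  have one: "(\<lambda>\<omega>. \<Sum>x\<in>UNIV. ?I x \<omega>) = (\<lambda>_. 1)"
    by (simp add: indicator_def fun_eq_iff)
  have "AE \<omega> in P. real_cond_exp P past_algebra (\<lambda>\<omega>. \<Sum>x\<in>UNIV. ?I x \<omega>) \<omega>
      = (\<Sum>x\<in>UNIV. cond_mass P \<omega> x)"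
    unfolding cond_mass_def using int by (rule real_cond_exp_sum)
  moreover have "AE \<omega> in P. real_cond_exp P past_algebra (\<lambda>_. 1) \<omega> = 1"
    by (rule real_cond_exp_F_meas) simp_all
  ultimately have "AE \<omega> in P. (\<Sum>x\<in>UNIV. cond_mass P \<omega> x) = 1"
    unfolding one by eventually_elim simp
  with nonneg show ?thesis
    by eventually_elim simp
qed

lemma AE_cond_mass_bounds: "AE \<omega> in P. cond_mass P \<omega> x \<in> {0..1}"
  using AE_cond_mass_pmf
proof eventually_elim
  case (elim \<omega>)
  then show ?case
    using member_le_sum[of x UNIV "cond_mass P \<omega>"] by simp
qed

lemma integrable_cond_mass [simp]: "integrable P (\<lambda>\<omega>. cond_mass P \<omega> x)"
proof (rule integrable_const_bound)
  show "AE \<omega> in P. norm (cond_mass P \<omega> x) \<le> 1"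
    using AE_cond_mass_bounds[of x] by eventually_elim simp
qed measurable

lemma integrable_cond_mass_log: "integrable P (\<lambda>\<omega>. cond_mass P \<omega> x * log 2 (cond_mass P \<omega> x))"
proof -
  \<comment> \<open>The comparison with \<open>v = 1\<close>, where \<open>v * log v\<close> vanishes, bounds \<open>u * log u\<close>.\<close>
  obtain C where C: "0 \<le> C" "\<And>u v. u \<in> {0..1} \<Longrightarrow> v \<in> {0..1} \<Longrightarrow>
      \<bar>u * log 2 u - v * log 2 v\<bar> \<le> 1 + C * \<bar>u - v\<bar>"
    using xlogx_approx_Lipschitz[of 1] by auto
  show ?thesis
  proof (rule integrable_const_bound[where B="1 + C"])
    show "AE \<omega> in P. norm (cond_mass P \<omega> x * log 2 (cond_mass P \<omega> x)) \<le> 1 + C"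
      using AE_cond_mass_bounds[of x]
    proof eventually_elim
      case (elim \<omega>)
      then have "C * \<bar>cond_mass P \<omega> x - 1\<bar> \<le> C * 1"
        using C(1) by (intro mult_left_mono) auto
      then show ?case
        using C(2)[OF elim, of 1] by simp
    qed
  qed measurable
qed

section \<open>Approximation by functions of a finite past\<close>

text \<open>
  The closure in \<open>L\<^sup>1\<close> of the functions of finitely many past coordinates. The closure properties
  below show that it contains every integrable function of the whole past.
\<close>
definition past_approximable :: "((int \<Rightarrow> 'a) \<Rightarrow> real) \<Rightarrow> bool" where
  "past_approximable f \<longleftrightarrow>
     integrable P f \<and> (\<forall>\<epsilon>>0. \<exists>t r. (\<integral>\<omega>. \<bar>f \<omega> - r (past t \<omega>)\<bar> \<partial>P) < \<epsilon>)"

lemma past_approximableD: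
  assumes "past_approximable f" "0 < \<epsilon>"
  obtains t r where "(\<integral>\<omega>. \<bar>f \<omega> - r (past t \<omega>)\<bar> \<partial>P) < \<epsilon>"
  using assms unfolding past_approximable_def by blast

lemma past_approximable_integrable: "past_approximable f \<Longrightarrow> integrable P f"
  by (simp add: past_approximable_def)

lemma past_approximable_past: "past_approximable (\<lambda>\<omega>. r (past t \<omega>))"
  unfolding past_approximable_def
proof (intro conjI allI impI exI)
  show "(\<integral>\<omega>. \<bar>r (past t \<omega>) - r (past t \<omega>)\<bar> \<partial>P) < \<epsilon>" if "0 < \<epsilon>" for \<epsilon> :: real
    using that by simp
qed simp

lemma past_approximable_add:
  assumes f: "past_approximable f" and g: "past_approximable g"
  shows "past_approximable (\<lambda>\<omega>. f \<omega> + g \<omega>)"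
  unfolding past_approximable_def
proof (intro conjI allI impI)
  note [simp] = past_approximable_integrable[OF f] past_approximable_integrable[OF g]
  show "integrable P (\<lambda>\<omega>. f \<omega> + g \<omega>)"
    by simp
  fix \<epsilon> :: real assume "0 < \<epsilon>"
  then have half: "0 < \<epsilon> / 2" by simp
  obtain s r where sr: "(\<integral>\<omega>. \<bar>f \<omega> - r (past s \<omega>)\<bar> \<partial>P) < \<epsilon> / 2"
    using past_approximableD[OF f half] .
  obtain t q where tq: "(\<integral>\<omega>. \<bar>g \<omega> - q (past t \<omega>)\<bar> \<partial>P) < \<epsilon> / 2"
    using past_approximableD[OF g half] .
  \<comment> \<open>Both approximations are functions of the longer of the two pasts; dropping its oldest
      symbols recovers the shorter one.\<close>
  let ?u = "\<lambda>ys. r (drop (max s t - s) ys) + q (drop (max s t - t) ys)"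
  have u: "?u (past (max s t) \<omega>) = r (past s \<omega>) + q (past t \<omega>)" for \<omega>
    by (simp flip: past_eq_drop)
  have "(\<integral>\<omega>. \<bar>f \<omega> + g \<omega> - ?u (past (max s t) \<omega>)\<bar> \<partial>P)
      \<le> (\<integral>\<omega>. \<bar>f \<omega> - r (past s \<omega>)\<bar> + \<bar>g \<omega> - q (past t \<omega>)\<bar> \<partial>P)"
    unfolding u by (rule integral_mono) auto
  also have "\<dots> = (\<integral>\<omega>. \<bar>f \<omega> - r (past s \<omega>)\<bar> \<partial>P) + (\<integral>\<omega>. \<bar>g \<omega> - q (past t \<omega>)\<bar> \<partial>P)"
    by (rule Bochner_Integration.integral_add) auto
  also have "\<dots> < \<epsilon>"
    using sr tq by simp
  finally show "\<exists>t r. (\<integral>\<omega>. \<bar>f \<omega> + g \<omega> - r (past t \<omega>)\<bar> \<partial>P) < \<epsilon>"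
    by (intro exI[of _ "max s t"] exI[of _ ?u])
qed

lemma past_approximable_lim:
  assumes s: "\<And>n. past_approximable (s n)" and lim: "\<And>\<omega>. (\<lambda>n. s n \<omega>) \<longlonglongrightarrow> f \<omega>"
    and w: "integrable P w" "\<And>n \<omega>. \<bar>s n \<omega>\<bar> \<le> w \<omega>"
  shows "past_approximable f"
  unfolding past_approximable_def
proof (intro conjI allI impI)
  note [simp] = past_approximable_integrable[OF s]
  have meas [measurable]: "s n \<in> borel_measurable P" for n
    by (rule borel_measurable_integrable) simp
  have meas_f [measurable]: "f \<in> borel_measurable P"
    by (rule borel_measurable_LIMSEQ_real[OF lim meas])
  show f: "integrable P f"
    by (rule integrable_dominated_convergence[of f P s w]) (simp_all add: lim w)
  have "\<bar>f \<omega>\<bar> \<le> w \<omega>" for \<omega>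
    by (rule LIMSEQ_le_const2[OF tendsto_rabs[OF lim]]) (simp add: w)
  then have bound: "\<bar>f \<omega> - s n \<omega>\<bar> \<le> 2 * w \<omega>" for n \<omega>
    using w(2)[of n \<omega>] by (smt (verit))
  have "(\<lambda>n. \<integral>\<omega>. \<bar>f \<omega> - s n \<omega>\<bar> \<partial>P) \<longlonglongrightarrow> (\<integral>\<omega>. 0 \<partial>P)"
  proof (rule integral_dominated_convergence[where w="\<lambda>\<omega>. 2 * w \<omega>"])
    have "(\<lambda>n. \<bar>f \<omega> - s n \<omega>\<bar>) \<longlonglongrightarrow> \<bar>f \<omega> - f \<omega>\<bar>" for \<omega>
      by (intro tendsto_intros lim)
    then show "AE \<omega> in P. (\<lambda>n. \<bar>f \<omega> - s n \<omega>\<bar>) \<longlonglongrightarrow> 0"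
      by simp
  qed (use bound w in auto)
  then have L1: "(\<lambda>n. \<integral>\<omega>. \<bar>f \<omega> - s n \<omega>\<bar> \<partial>P) \<longlonglongrightarrow> 0"
    by simp
  fix \<epsilon> :: real assume "0 < \<epsilon>"
  then have half: "0 < \<epsilon> / 2" by simp
  obtain n where n: "(\<integral>\<omega>. \<bar>f \<omega> - s n \<omega>\<bar> \<partial>P) < \<epsilon> / 2"
    using order_tendstoD(2)[OF L1 half] eventually_happens'[OF sequentially_bot] by blast
  obtain t r where tr: "(\<integral>\<omega>. \<bar>s n \<omega> - r (past t \<omega>)\<bar> \<partial>P) < \<epsilon> / 2"
    using past_approximableD[OF s half] .
  have "(\<integral>\<omega>. \<bar>f \<omega> - r (past t \<omega>)\<bar> \<partial>P)
      \<le> (\<integral>\<omega>. \<bar>f \<omega> - s n \<omega>\<bar> + \<bar>s n \<omega> - r (past t \<omega>)\<bar> \<partial>P)"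
    using f by (intro integral_mono) auto
  also have "\<dots> = (\<integral>\<omega>. \<bar>f \<omega> - s n \<omega>\<bar> \<partial>P) + (\<integral>\<omega>. \<bar>s n \<omega> - r (past t \<omega>)\<bar> \<partial>P)"
    using f by (intro Bochner_Integration.integral_add) auto
  also have "\<dots> < \<epsilon>"
    using n tr by simp
  finally show "\<exists>t r. (\<integral>\<omega>. \<bar>f \<omega> - r (past t \<omega>)\<bar> \<partial>P) < \<epsilon>"
    by blast
qed

lemma past_approximable_cmult:
  assumes f: "past_approximable f"
  shows "past_approximable (\<lambda>\<omega>. c * f \<omega>)"
  unfolding past_approximable_def
proof (intro conjI allI impI)
  show "integrable P (\<lambda>\<omega>. c * f \<omega>)"
    using past_approximable_integrable[OF f] by simp
  fix \<epsilon> :: real assume "0 < \<epsilon>"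
  then have pos: "0 < \<epsilon> / (\<bar>c\<bar> + 1)"
    by (simp add: add_nonneg_pos)
  obtain t r where tr: "(\<integral>\<omega>. \<bar>f \<omega> - r (past t \<omega>)\<bar> \<partial>P) < \<epsilon> / (\<bar>c\<bar> + 1)"
    using past_approximableD[OF f pos] .
  have nonneg: "0 \<le> (\<integral>\<omega>. \<bar>f \<omega> - r (past t \<omega>)\<bar> \<partial>P)"
    by simp
  have "(\<integral>\<omega>. \<bar>c * f \<omega> - c * r (past t \<omega>)\<bar> \<partial>P) = (\<integral>\<omega>. \<bar>c\<bar> * \<bar>f \<omega> - r (past t \<omega>)\<bar> \<partial>P)"
    by (simp only: abs_mult[symmetric] right_diff_distrib)
  also have "\<dots> = \<bar>c\<bar> * (\<integral>\<omega>. \<bar>f \<omega> - r (past t \<omega>)\<bar> \<partial>P)"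
    by simp
  also have "\<dots> \<le> (\<bar>c\<bar> + 1) * (\<integral>\<omega>. \<bar>f \<omega> - r (past t \<omega>)\<bar> \<partial>P)"
    using nonneg by (intro mult_right_mono) auto
  also have "\<dots> < \<epsilon>"
    using tr by (simp add: field_simps)
  finally show "\<exists>t r. (\<integral>\<omega>. \<bar>c * f \<omega> - r (past t \<omega>)\<bar> \<partial>P) < \<epsilon>"
    by (intro exI[of _ t] exI[of _ "\<lambda>ys. c * r ys"])
qed

text \<open>
  The events with approximable indicator form a Dynkin system containing the cylinders: complements
  and finite disjoint unions come from linearity, countable ones from dominated convergence.
\<close>
lemma past_approximable_indicator:
  assumes "A \<in> sets past_algebra"
  shows "past_approximable (indicator A)"
proof -
  let ?G = "{past t -` B | t (B :: 'a list set). True}"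
  have past_approximable_empty: "past_approximable (indicator {})"
  proof -
    have "indicator {} = (\<lambda>\<omega> :: int \<Rightarrow> 'a. 0 :: real)"
      by (rule ext) simp
    then show ?thesis
      using past_approximable_past[of "\<lambda>_. 0" 0] by (simp only:)
  qed
  have sub: "?G \<subseteq> Pow UNIV"
    by simp
  have "A \<in> sigma_sets UNIV ?G"
    using assms past_algebra_subset_cylinders by blast
  with Int_stable_cylinders sub show ?thesis
  proof (induction rule: sigma_sets_induct_disjoint)
    case (basic A)
    then obtain t B where "A = past t -` B"
      by blast
    then have eq: "indicator A = (\<lambda>\<omega>. indicator B (past t \<omega>) :: real)"
      by (intro ext) (auto split: split_indicator)
    show ?case
      unfolding eq by (rule past_approximable_past)
  next
    case empty
    show ?case
      by (rule past_approximable_empty)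
  next
    case (compl A)
    have eq: "indicator (UNIV - A) = (\<lambda>\<omega>. 1 + - 1 * indicator A \<omega> :: real)"
      by (intro ext) (auto split: split_indicator)
    show ?case
      unfolding eq by (intro past_approximable_add past_approximable_cmult compl
          past_approximable_past[of "\<lambda>_. 1" 0])
  next
    case (union A)
    have partial: "past_approximable (indicator (\<Union>i<n. A i))" for n
    proof (induction n)
      case 0
      show ?case
        using past_approximable_empty by (simp only: lessThan_0 image_empty Sup_empty)
    next
      case (Suc n)
      have "(\<Union>i<n. A i) \<inter> A n = {}"
      proof -
        have "A i \<inter> A n = {}" if "i < n" for i
          using disjoint_family_onD[OF union(1), of i n] that by simp
        then show ?thesis
          by blast
      qed
      then have "indicator ((\<Union>i<n. A i) \<union> A n) \<omega>
          = (indicator (\<Union>i<n. A i) \<omega> + indicator (A n) \<omega> :: real)" for \<omega>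
        by (rule indicator_add[symmetric])
      moreover have "(\<Union>i<Suc n. A i) = (\<Union>i<n. A i) \<union> A n"
        by (simp only: lessThan_Suc UN_insert Un_commute)
      ultimately have eq: "indicator (\<Union>i<Suc n. A i)
          = (\<lambda>\<omega>. indicator (\<Union>i<n. A i) \<omega> + indicator (A n) \<omega> :: real)"
        by (intro ext) (simp only:)
      show ?case
        unfolding eq by (intro past_approximable_add Suc union)
    qed
    show ?case
    proof (rule past_approximable_lim[where s="\<lambda>n. indicator (\<Union>i<n. A i)" and w="\<lambda>_. 1"])
      show "(\<lambda>n. indicator (\<Union>i<n. A i) \<omega> :: real) \<longlonglongrightarrow> indicator (\<Union>i. A i) \<omega>" for \<omega>
        by (rule LIMSEQ_indicator_UN)
      show "\<bar>indicator (\<Union>i<n. A i) \<omega> :: real\<bar> \<le> 1" for n \<omega>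
        by (rule indicator_abs_le_1)
    qed (rule partial, simp)
  qed
qed

lemma past_approximable_past_measurable:
  assumes "integrable P f" "f \<in> borel_measurable past_algebra"
  shows "past_approximable f"
proof -
  have "integrable (restr_to_subalg P past_algebra) f"
    using assms by (intro integrable_in_subalg subalg)
  then show ?thesis
  proof (induction rule: integrable_induct)
    case (base A c)
    then have "past_approximable (\<lambda>\<omega>. c * indicator A \<omega>)"
      by (intro past_approximable_cmult past_approximable_indicator)
        (simp add: sets_restr_to_subalg[OF subalg])
    then show ?case
      by (simp add: mult.commute)
  next
    case (add f g)
    then show ?case
      by (intro past_approximable_add)
  next
    case (lim f s)
    have f: "integrable P f"
      using lim by (intro integrable_from_subalg[OF subalg])
    show ?case
      by (rule past_approximable_lim[of s _ "\<lambda>\<omega>. 2 * \<bar>f \<omega>\<bar>"])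
        (use lim f in \<open>simp_all add: space_restr_to_subalg\<close>)
  qed
qed

text \<open>
  Take \<open>q (past t \<omega>)\<close> close to \<open>cond_mass P \<omega> x\<close> in \<open>L\<^sup>1\<close>; every longer past can express the same
  function. Since \<open>word_cond (past t \<omega>) x\<close> is the conditional expectation of \<open>cond_mass P \<omega> x\<close>
  given \<open>X\<^sup>-\<^sup>t\<close>, it is no farther from \<open>q\<close> than \<open>cond_mass P \<omega> x\<close> is.
\<close>
lemma word_cond_tendsto_cond_mass:
  "(\<lambda>t. \<integral>\<omega>. \<bar>cond_mass P \<omega> x - word_cond (past t \<omega>) x\<bar> \<partial>P) \<longlonglongrightarrow> 0"
proof (rule LIMSEQ_I)
  fix \<epsilon> :: real assume "0 < \<epsilon>"
  then have half: "0 < \<epsilon> / 2" by simp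
  have "past_approximable (\<lambda>\<omega>. cond_mass P \<omega> x)"
    by (intro past_approximable_past_measurable integrable_cond_mass
        measurable_past_algebra_cond_mass)
  then obtain s r where sr: "(\<integral>\<omega>. \<bar>cond_mass P \<omega> x - r (past s \<omega>)\<bar> \<partial>P) < \<epsilon> / 2"
    by (rule past_approximableD[OF _ half])
  have "(\<integral>\<omega>. \<bar>cond_mass P \<omega> x - word_cond (past t \<omega>) x\<bar> \<partial>P) < \<epsilon>" if "s \<le> t" for t
  proof -
    define q where "q ys = r (drop (t - s) ys)" for ys
    have q: "q (past t \<omega>) = r (past s \<omega>)" for \<omega>
      using that by (simp add: q_def flip: past_eq_drop)
    let ?e = "\<integral>\<omega>. \<bar>cond_mass P \<omega> x - q (past t \<omega>)\<bar> \<partial>P"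
    \<comment> \<open>The sign turns the \<open>L\<^sup>1\<close> distance into a linear expression, in which conditional masses
        given the finite and the infinite past are interchangeable.\<close>
    define \<sigma> where "\<sigma> ys = sgn (q ys - word_cond ys x)" for ys
    have int: "integrable P (\<lambda>\<omega>. \<sigma> (past t \<omega>) * cond_mass P \<omega> x)"
      by (rule expectation_cond_mass(1))
    have "(\<integral>\<omega>. \<bar>q (past t \<omega>) - word_cond (past t \<omega>) x\<bar> \<partial>P)
        = (\<integral>\<omega>. \<sigma> (past t \<omega>) * q (past t \<omega>) - \<sigma> (past t \<omega>) * word_cond (past t \<omega>) x \<partial>P)"
      by (simp add: \<sigma>_def abs_sgn algebra_simps)
    also have "\<dots> = (\<integral>\<omega>. \<sigma> (past t \<omega>) * q (past t \<omega>) \<partial>P)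
        - (\<integral>\<omega>. \<sigma> (past t \<omega>) * word_cond (past t \<omega>) x \<partial>P)"
      using integrable_past[of "\<lambda>ys. \<sigma> ys * q ys" t] integrable_past[of "\<lambda>ys. \<sigma> ys * word_cond ys x" t]
      by (rule Bochner_Integration.integral_diff)
    also have "\<dots> = (\<integral>\<omega>. \<sigma> (past t \<omega>) * q (past t \<omega>) \<partial>P)
        - (\<integral>\<omega>. \<sigma> (past t \<omega>) * cond_mass P \<omega> x \<partial>P)"
      by (simp only: expectation_word_cond expectation_cond_mass(2))
    also have "\<dots> = (\<integral>\<omega>. \<sigma> (past t \<omega>) * q (past t \<omega>) - \<sigma> (past t \<omega>) * cond_mass P \<omega> x \<partial>P)"
      using integrable_past[of "\<lambda>ys. \<sigma> ys * q ys" t] int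
      by (rule Bochner_Integration.integral_diff[symmetric])
    also have "\<dots> \<le> ?e"
    proof (rule integral_mono)
      show "integrable P (\<lambda>\<omega>. \<sigma> (past t \<omega>) * q (past t \<omega>) - \<sigma> (past t \<omega>) * cond_mass P \<omega> x)"
        using integrable_past[of "\<lambda>ys. \<sigma> ys * q ys" t] int by (rule Bochner_Integration.integrable_diff)
      show "\<sigma> (past t \<omega>) * q (past t \<omega>) - \<sigma> (past t \<omega>) * cond_mass P \<omega> x
          \<le> \<bar>cond_mass P \<omega> x - q (past t \<omega>)\<bar>" for \<omega>
        unfolding \<sigma>_def by (auto simp: sgn_if)
    qed simp
    finally have proj: "(\<integral>\<omega>. \<bar>q (past t \<omega>) - word_cond (past t \<omega>) x\<bar> \<partial>P) \<le> ?e" .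
    have "(\<integral>\<omega>. \<bar>cond_mass P \<omega> x - word_cond (past t \<omega>) x\<bar> \<partial>P)
        \<le> (\<integral>\<omega>. \<bar>cond_mass P \<omega> x - q (past t \<omega>)\<bar> + \<bar>q (past t \<omega>) - word_cond (past t \<omega>) x\<bar> \<partial>P)"
      using integrable_past[of "\<lambda>ys. word_cond ys x" t] by (intro integral_mono) auto
    also have "\<dots> = ?e + (\<integral>\<omega>. \<bar>q (past t \<omega>) - word_cond (past t \<omega>) x\<bar> \<partial>P)"
      using integrable_past[of "\<lambda>ys. word_cond ys x" t]
      by (intro Bochner_Integration.integral_add) auto
    also have "\<dots> < \<epsilon>"
      using proj sr unfolding q by simp
    finally show ?thesis .
  qed
  then show "\<exists>N. \<forall>t\<ge>N. norm ((\<integral>\<omega>. \<bar>cond_mass P \<omega> x - word_cond (past t \<omega>) x\<bar> \<partial>P) - 0) < \<epsilon>"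
    by (intro exI[of _ s]) simp
qed

section \<open>Entropy given a finite past\<close>

text \<open>
  The difference \<open>H(X | X\<^sup>-\<^sup>t) - H(X | X\<^sup>-)\<close> of conditional entropies, the first one moved to the
  block \<open>(X\<^sup>t, X\<^sub>t)\<close> so that the sum over \<open>t\<close> telescopes.
\<close>
definition entropy_gap :: "nat \<Rightarrow> real" where
  "entropy_gap t = (\<integral>\<omega>. (\<Sum>x\<in>UNIV. cond_mass P \<omega> x * log 2 (cond_mass P \<omega> x)) \<partial>P)
     - (\<integral>\<omega>. log 2 (word_cond (block t \<omega>) (\<omega> (int t))) \<partial>P)"

text \<open>
  The logarithm of \<open>word_cond\<close> is a function of \<open>X\<^sup>-\<^sup>t\<close>, so the weight \<open>cond_mass\<close> in front of it may
  be replaced by \<open>word_cond\<close>. Both entropies are then expectations of the same continuous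
  function \<open>u * log u\<close>.
\<close>
lemma entropy_gap_eq:
  "entropy_gap t = (\<Sum>x\<in>UNIV. \<integral>\<omega>. cond_mass P \<omega> x * log 2 (cond_mass P \<omega> x)
     - word_cond (past t \<omega>) x * log 2 (word_cond (past t \<omega>) x) \<partial>P)"
proof -
  have "(\<integral>\<omega>. log 2 (word_cond (block t \<omega>) (\<omega> (int t))) \<partial>P)
      = (\<integral>\<omega>. (\<Sum>x\<in>UNIV. cond_mass P \<omega> x * log 2 (word_cond (past t \<omega>) x)) \<partial>P)"
    by (rule expectation_cond_mass_sum[symmetric, of "\<lambda>ys x. log 2 (word_cond ys x)"])
  also have "\<dots> = (\<Sum>x\<in>UNIV. \<integral>\<omega>. log 2 (word_cond (past t \<omega>) x) * cond_mass P \<omega> x \<partial>P)"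
    using expectation_cond_mass(1)[of "\<lambda>ys. log 2 (word_cond ys _)" t]
    by (subst Bochner_Integration.integral_sum) (simp_all add: mult.commute)
  also have "\<dots> = (\<Sum>x\<in>UNIV. \<integral>\<omega>. log 2 (word_cond (past t \<omega>) x) * word_cond (past t \<omega>) x \<partial>P)"
    by (simp only: expectation_cond_mass(2)[of "\<lambda>ys. log 2 (word_cond ys _)" t]
        expectation_word_cond[of "\<lambda>ys. log 2 (word_cond ys _)" t])
  finally show ?thesis
    unfolding entropy_gap_def
    using integrable_cond_mass_log integrable_past[of "\<lambda>ys. word_cond ys _ * log 2 (word_cond ys _)" t]
    by (simp add: sum_subtractf mult.commute)
qed

lemma entropy_gap_tendsto_0: "entropy_gap \<longlonglongrightarrow> 0"
proof -
  let ?\<phi> = "\<lambda>u::real. u * log 2 u"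
  have "(\<lambda>t. \<integral>\<omega>. ?\<phi> (cond_mass P \<omega> x) - ?\<phi> (word_cond (past t \<omega>) x) \<partial>P) \<longlonglongrightarrow> 0" for x
  proof (rule LIMSEQ_I)
    fix \<epsilon> :: real assume "0 < \<epsilon>"
    then have half: "0 < \<epsilon> / 2" by simp
    obtain C where C: "0 \<le> C" "\<And>u v. u \<in> {0..1} \<Longrightarrow> v \<in> {0..1} \<Longrightarrow> \<bar>?\<phi> u - ?\<phi> v\<bar> \<le> \<epsilon> / 2 + C * \<bar>u - v\<bar>"
      using xlogx_approx_Lipschitz[OF half] by blast
    let ?d = "\<lambda>t. \<integral>\<omega>. \<bar>cond_mass P \<omega> x - word_cond (past t \<omega>) x\<bar> \<partial>P"
    have "(\<lambda>t. \<epsilon> / 2 + C * ?d t) \<longlonglongrightarrow> \<epsilon> / 2 + C * 0"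
      by (intro tendsto_intros word_cond_tendsto_cond_mass)
    from order_tendstoD(2)[OF this, of \<epsilon>] half
    have "\<forall>\<^sub>F t in sequentially. \<epsilon> / 2 + C * ?d t < \<epsilon>"
      by simp
    then obtain N where N: "\<And>t. N \<le> t \<Longrightarrow> \<epsilon> / 2 + C * ?d t < \<epsilon>"
      unfolding eventually_sequentially by blast
    have "norm ((\<integral>\<omega>. ?\<phi> (cond_mass P \<omega> x) - ?\<phi> (word_cond (past t \<omega>) x) \<partial>P) - 0) < \<epsilon>" if "N \<le> t" for t
    proof -
      note int = integrable_past[of "\<lambda>ys. ?\<phi> (word_cond ys x)" t] integrable_past[of "\<lambda>ys. word_cond ys x" t]
      have "norm (\<integral>\<omega>. ?\<phi> (cond_mass P \<omega> x) - ?\<phi> (word_cond (past t \<omega>) x) \<partial>P)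
          \<le> (\<integral>\<omega>. norm (?\<phi> (cond_mass P \<omega> x) - ?\<phi> (word_cond (past t \<omega>) x)) \<partial>P)"
        by (rule integral_norm_bound)
      also have "\<dots> \<le> (\<integral>\<omega>. \<epsilon> / 2 + C * \<bar>cond_mass P \<omega> x - word_cond (past t \<omega>) x\<bar> \<partial>P)"
      proof (rule integral_mono_AE)
        show "AE \<omega> in P. norm (?\<phi> (cond_mass P \<omega> x) - ?\<phi> (word_cond (past t \<omega>) x))
            \<le> \<epsilon> / 2 + C * \<bar>cond_mass P \<omega> x - word_cond (past t \<omega>) x\<bar>"
          using AE_cond_mass_bounds[of x]
        proof eventually_elim
          case (elim \<omega>)
          then show ?case
            unfolding real_norm_def by (rule C(2)) (rule word_cond_bounds)
        qed
      qed (use int integrable_cond_mass_log in auto)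
      also have "\<dots> = \<epsilon> / 2 + C * ?d t"
        using int by (subst Bochner_Integration.integral_add) (auto simp: prob_space[unfolded space_P])
      also have "\<dots> < \<epsilon>"
        by (rule N[OF that])
      finally show ?thesis
        by simp
    qed
    then show "\<exists>N. \<forall>t\<ge>N. norm ((\<integral>\<omega>. ?\<phi> (cond_mass P \<omega> x) - ?\<phi> (word_cond (past t \<omega>) x) \<partial>P) - 0) < \<epsilon>"
      by blast
  qed
  then have "(\<lambda>t. \<Sum>x\<in>UNIV. \<integral>\<omega>. ?\<phi> (cond_mass P \<omega> x) - ?\<phi> (word_cond (past t \<omega>) x) \<partial>P) \<longlonglongrightarrow> (\<Sum>x\<in>(UNIV :: 'a set). 0)"
    by (intro tendsto_sum)
  then show ?thesis
    by (simp only: entropy_gap_eq[abs_def] sum.neutral_const)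
qed

section \<open>Comparison of the estimates with the models\<close>

lemma sum_log_word_cond:
  assumes "0 < block_mass P n (block n \<omega>)"
  shows "(\<Sum>t<n. log 2 (word_cond (block t \<omega>) (\<omega> (int t)))) = log 2 (block_mass P n (block n \<omega>))"
  using assms
proof (induction n)
  case 0
  have "block_mass P 0 (block 0 \<omega>) = 1"
    using prob_space by (simp add: block_mass_eq block_def)
  then show ?case
    by simp
next
  case (Suc n)
  let ?b = "block n \<omega>" and ?x = "\<omega> (int n)"
  have pos': "0 < block_mass P (Suc n) (?b @ [?x])"
    using Suc.prems by (simp add: block_Suc)
  then have pos: "0 < block_mass P n ?b"
    using block_mass_snoc_le by (rule less_le_trans)
  have "log 2 (word_cond ?b ?x) = log 2 (block_mass P (Suc n) (?b @ [?x])) - log 2 (block_mass P n ?b)"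
    using pos pos' unfolding word_cond_def by (simp add: log_divide_pos)
  then show ?case
    using Suc.IH[OF pos] by (simp add: block_Suc)
qed

text \<open>
  On the event \<open>F (past t \<omega>) x = 0\<close>, which depends on \<open>X\<^sup>-\<^sup>t\<close> only, the integral of \<open>cond_mass P \<omega> x\<close>
  is the probability that \<open>X\<^sub>0 = x\<close> in addition, and this is zero by assumption.
\<close>
lemma AE_cond_mass_dominated:
  fixes F :: "'a list \<Rightarrow> 'a \<Rightarrow> real"
  assumes "AE \<omega> in P. F (block t \<omega>) (\<omega> (int t)) \<noteq> 0"
  shows "AE \<omega> in P. \<forall>x. cond_mass P \<omega> x \<noteq> 0 \<longrightarrow> F (past t \<omega>) x \<noteq> 0"
proof -
  have "AE \<omega> in P. \<forall>x\<in>UNIV. cond_mass P \<omega> x \<noteq> 0 \<longrightarrow> F (past t \<omega>) x \<noteq> 0"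
  proof (rule AE_finite_allI)
    fix x :: 'a
    define f :: "'a list \<Rightarrow> real" where "f ys = of_bool (F ys x = 0)" for ys
    have "(\<integral>\<omega>. f (past t \<omega>) * cond_mass P \<omega> x \<partial>P)
        = (\<integral>\<omega>. f (past t \<omega>) * of_bool (\<omega> 0 = x) \<partial>P)"
      unfolding expectation_cond_mass(2) by (simp add: indicator_def of_bool_def)
    also have "\<dots> = (\<integral>\<omega>. f (block t \<omega>) * of_bool (\<omega> (int t) = x) \<partial>P)"
      by (rule expectation_past_coord[of "\<lambda>ys a. f ys * of_bool (a = x)"])
    also have "\<dots> = 0"
    proof (rule integral_eq_zero_AE)
      show "AE \<omega> in P. f (block t \<omega>) * of_bool (\<omega> (int t) = x) = 0"
        using assms by eventually_elim (auto simp: f_def)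
    qed
    finally have zero: "(\<integral>\<omega>. f (past t \<omega>) * cond_mass P \<omega> x \<partial>P) = 0" .
    have "AE \<omega> in P. 0 \<le> f (past t \<omega>) * cond_mass P \<omega> x"
      using AE_cond_mass_bounds[of x] by eventually_elim (simp add: f_def)
    with zero have "AE \<omega> in P. f (past t \<omega>) * cond_mass P \<omega> x = 0"
      using integral_nonneg_eq_0_iff_AE[OF expectation_cond_mass(1)] by blast
    then show "AE \<omega> in P. cond_mass P \<omega> x \<noteq> 0 \<longrightarrow> F (past t \<omega>) x \<noteq> 0"
      by eventually_elim (auto simp: f_def)
  qed simp
  then show ?thesis
    by simp
qed

end

text \<open>
  If a word has positive mass then so have all its prefixes, and on those \<open>K\<close> is the true
  conditional, that is, the ratio of the masses of consecutive prefixes. The logarithms of these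
  ratios telescope.
\<close>
lemma conditionals_chain_rule:
  fixes Q :: "nat \<Rightarrow> 'a list pmf"
  assumes K: "conditionals_of Q K" and supp: "set_pmf (Q n) \<subseteq> {xs. length xs = n}"
    and xs: "length xs = n" "pmf (Q n) xs \<noteq> 0"
  shows "t < n \<Longrightarrow> 0 < pmf (K n (take t xs)) (xs ! t)"
    and "(\<Sum>t<n. log 2 (pmf (K n (take t xs)) (xs ! t))) = log 2 (pmf (Q n) xs)"
proof -
  define m where "m t = \<P>(zs in Q n. take t zs = take t xs)" for t
  have len: "length zs = n" if "zs \<in> set_pmf (Q n)" for zs
    using that supp by auto
  have "pmf (Q n) xs \<le> m t" for t
    unfolding m_def measure_pmf_single[symmetric]
    by (rule measure_pmf.finite_measure_mono) auto
  then have pos: "0 < m t" for t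
    using xs(2) pmf_nonneg[of "Q n" xs] by (smt (verit))
  have m0: "m 0 = 1"
    by (simp add: m_def)
  have mn: "m n = pmf (Q n) xs"
    unfolding m_def measure_pmf_single[symmetric]
    by (rule measure_pmf.finite_measure_eq_AE) (auto simp: AE_measure_pmf_iff len xs)
  have step: "pmf (K n (take t xs)) (xs ! t) = m (Suc t) / m t" if t: "t < n" for t
  proof -
    have "m (Suc t) = \<P>(zs in Q n. zs ! t = xs ! t \<and> take t zs = take t xs)"
      unfolding m_def using t xs(1)
      by (intro measure_pmf.finite_measure_eq_AE)
        (auto simp: AE_measure_pmf_iff len take_Suc_conv_app_nth)
    moreover have "pmf (K n (take t xs)) (xs ! t)
        = \<P>(zs in Q n. zs ! t = xs ! t \<bar> take t zs = take t xs)"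
      using K t xs(1) pos[of t] unfolding conditionals_of_def m_def by simp
    ultimately show ?thesis
      unfolding cond_prob_def m_def by simp
  qed
  then show "t < n \<Longrightarrow> 0 < pmf (K n (take t xs)) (xs ! t)" for t
    using pos by simp
  have "(\<Sum>t<n. log 2 (pmf (K n (take t xs)) (xs ! t))) = (\<Sum>t<n. log 2 (m (Suc t)) - log 2 (m t))"
    by (rule sum.cong) (use pos in \<open>simp_all add: step log_divide_pos\<close>)
  also have "\<dots> = log 2 (m n) - log 2 (m 0)"
    by (rule sum_lessThan_telescope)
  finally show "(\<Sum>t<n. log 2 (pmf (K n (take t xs)) (xs ! t))) = log 2 (pmf (Q n) xs)"
    by (simp add: m0 mn)
qed

context stationary_process
begin

lemma info_div_block_eq:
  assumes "\<And>xs. length xs = n \<Longrightarrow> block_mass P n xs \<noteq> 0 \<Longrightarrow> pmf q xs \<noteq> 0"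
  shows "info_div {xs. length xs = n} (block_mass P n) (pmf q)
    = ereal (\<integral>\<omega>. log 2 (block_mass P n (block n \<omega>) / pmf q (block n \<omega>)) \<partial>P)"
  unfolding expectation_block[of "\<lambda>xs. log 2 (block_mass P n xs / pmf q xs)"]
  by (rule info_div_eq_ereal) (use assms in blast)

lemma info_div_block_not_dominated:
  assumes "length xs = n" "block_mass P n xs \<noteq> 0" "pmf q xs = 0"
  shows "info_div {xs. length xs = n} (block_mass P n) (pmf q) = \<infinity>"
proof -
  have "0 < block_mass P n xs"
    using assms(2) block_mass_nonneg[of n xs] by linarith
  then have "ereal (block_mass P n xs) * log_ratio (block_mass P n xs) (pmf q xs) = \<infinity>"
    using assms by (simp add: log_ratio_def)
  then show ?thesis
    unfolding info_div_def sum_Pinfty using assms(1) by (intro conjI finite_words bexI[of _ xs]) auto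
qed

text \<open>
  The almost sure bound \<open>Y\<close> of \<open>info_div_mixture_le\<close> is integrable and almost surely
  nonnegative, so the expected
  divergence is at most its expectation. Its entropy term \<open>G\<close> is compared with the blocks of \<open>P\<close> by
  means of the entropy gaps, and its cross terms \<open>H t\<close> sum to the expectation of \<open>log Q(X\<^sup>n)\<close>.
\<close>
lemma expected_divergence_le_if_dominated:
  assumes n: "0 < n" and K: "conditionals_of Q K" and supp: "set_pmf (Q n) \<subseteq> {xs. length xs = n}"
    and dom: "\<And>xs. length xs = n \<Longrightarrow> block_mass P n xs \<noteq> 0 \<Longrightarrow> pmf (Q n) xs \<noteq> 0"
  shows "expected_divergence P (estimate K n)
    \<le> ennreal ((\<integral>\<omega>. log 2 (block_mass P n (block n \<omega>) / pmf (Q n) (block n \<omega>)) \<partial>P) / real n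
        + (\<Sum>t<n. entropy_gap t) / real n)"
proof -
  let ?g = "cond_mass P" and ?k = "\<lambda>t \<omega>. pmf (K n (past t \<omega>))"
  let ?p = "\<lambda>\<omega>. block_mass P n (block n \<omega>)" and ?q = "\<lambda>\<omega>. pmf (Q n) (block n \<omega>)"
  define G where "G \<omega> = (\<Sum>x\<in>UNIV. ?g \<omega> x * log 2 (?g \<omega> x))" for \<omega>
  define H where "H t \<omega> = (\<Sum>x\<in>UNIV. ?g \<omega> x * log 2 (?k t \<omega> x))" for t \<omega>
  define Y where "Y \<omega> = G \<omega> - (\<Sum>t<n. H t \<omega>) / real n" for \<omega>

  have qpos: "AE \<omega> in P. 0 < ?p \<omega> \<and> 0 < ?q \<omega>"
    using AE_block_mass_pos[of n]
  proof eventually_elim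
    case (elim \<omega>)
    then have "?q \<omega> \<noteq> 0"
      by (intro dom) auto
    with elim show ?case
      by (simp add: pmf_pos)
  qed
  have chain: "AE \<omega> in P. (\<forall>t<n. pmf (K n (block t \<omega>)) (\<omega> (int t)) \<noteq> 0)
      \<and> (\<Sum>t<n. log 2 (pmf (K n (block t \<omega>)) (\<omega> (int t)))) = log 2 (?q \<omega>)"
    using qpos
  proof eventually_elim
    case (elim \<omega>)
    then have q: "?q \<omega> \<noteq> 0"
      by simp
    have eq: "pmf (K n (take t (block n \<omega>))) (block n \<omega> ! t) = pmf (K n (block t \<omega>)) (\<omega> (int t))"
      if "t < n" for t
      using that by (simp add: take_block nth_block)
    have "(\<Sum>t<n. log 2 (pmf (K n (block t \<omega>)) (\<omega> (int t)))) = log 2 (?q \<omega>)"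
      unfolding conditionals_chain_rule(2)[OF K supp length_block q, symmetric]
      by (rule sum.cong) (simp_all add: eq)
    then show ?case
      using conditionals_chain_rule(1)[OF K supp length_block q] eq by force
  qed
  have "AE \<omega> in P. \<forall>t\<in>{..<n}. \<forall>x. ?g \<omega> x \<noteq> 0 \<longrightarrow> ?k t \<omega> x \<noteq> 0"
  proof (rule AE_finite_allI)
    fix t assume "t \<in> {..<n}"
    then have "AE \<omega> in P. pmf (K n (block t \<omega>)) (\<omega> (int t)) \<noteq> 0"
      using chain by (auto elim!: eventually_mono)
    then show "AE \<omega> in P. \<forall>x. ?g \<omega> x \<noteq> 0 \<longrightarrow> ?k t \<omega> x \<noteq> 0"
      by (rule AE_cond_mass_dominated)
  qed simp
  with AE_cond_mass_pmf have Y: "AE \<omega> in P. info_div UNIV (?g \<omega>) (estimate K n \<omega>) \<le> ereal (Y \<omega>) \<and> 0 \<le> Y \<omega>"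
  proof eventually_elim
    case (elim \<omega>)
    have "(\<Sum>x\<in>UNIV. ?k t \<omega> x) = 1" for t
      by (simp add: sum_pmf_eq_1)
    with elim n show ?case
      unfolding Y_def G_def H_def estimate_def[abs_def]
      by (intro conjI info_div_mixture_le) (auto simp: pmf_pos)
  qed

  have int_G: "integrable P G"
    unfolding G_def by (intro Bochner_Integration.integrable_sum integrable_cond_mass_log)
  have int_H: "integrable P (H t)" for t
    unfolding H_def
    using expectation_cond_mass(1)[of "\<lambda>ys. log 2 (pmf (K n ys) _)" t]
    by (intro Bochner_Integration.integrable_sum) (simp add: mult.commute)
  have int_Y: "integrable P Y"
    unfolding Y_def
    by (intro Bochner_Integration.integrable_diff integrable_divide_zero
        Bochner_Integration.integrable_sum int_G int_H)

  have "(\<Sum>t<n. \<integral>\<omega>. H t \<omega> \<partial>P)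
      = (\<Sum>t<n. \<integral>\<omega>. log 2 (pmf (K n (block t \<omega>)) (\<omega> (int t))) \<partial>P)"
    unfolding H_def by (simp only: expectation_cond_mass_sum[of "\<lambda>ys x. log 2 (pmf (K n ys) x)"])
  also have "\<dots> = (\<integral>\<omega>. (\<Sum>t<n. log 2 (pmf (K n (block t \<omega>)) (\<omega> (int t)))) \<partial>P)"
    by (rule Bochner_Integration.integral_sum[symmetric]) (rule integrable_block_coord)
  also have "\<dots> = (\<integral>\<omega>. log 2 (?q \<omega>) \<partial>P)"
  proof (rule integral_cong_AE)
    show "(\<lambda>\<omega>. \<Sum>t<n. log 2 (pmf (K n (block t \<omega>)) (\<omega> (int t)))) \<in> borel_measurable P"
      by (intro borel_measurable_sum borel_measurable_integrable integrable_block_coord)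
  qed (use chain in \<open>auto elim!: eventually_mono\<close>)
  finally have H_eq: "(\<Sum>t<n. \<integral>\<omega>. H t \<omega> \<partial>P) = (\<integral>\<omega>. log 2 (?q \<omega>) \<partial>P)" .

  have "(\<Sum>t<n. \<integral>\<omega>. log 2 (word_cond (block t \<omega>) (\<omega> (int t))) \<partial>P)
      = (\<integral>\<omega>. (\<Sum>t<n. log 2 (word_cond (block t \<omega>) (\<omega> (int t)))) \<partial>P)"
    by (rule Bochner_Integration.integral_sum[symmetric]) (rule integrable_block_coord)
  also have "\<dots> = (\<integral>\<omega>. log 2 (?p \<omega>) \<partial>P)"
  proof (rule integral_cong_AE)
    show "(\<lambda>\<omega>. \<Sum>t<n. log 2 (word_cond (block t \<omega>) (\<omega> (int t)))) \<in> borel_measurable P"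
      by (intro borel_measurable_sum borel_measurable_integrable integrable_block_coord)
    show "AE \<omega> in P. (\<Sum>t<n. log 2 (word_cond (block t \<omega>) (\<omega> (int t)))) = log 2 (?p \<omega>)"
      using AE_block_mass_pos[of n] by eventually_elim (rule sum_log_word_cond)
  qed simp
  finally have gaps: "(\<Sum>t<n. entropy_gap t) = real n * (\<integral>\<omega>. G \<omega> \<partial>P) - (\<integral>\<omega>. log 2 (?p \<omega>) \<partial>P)"
    unfolding entropy_gap_def G_def by (simp add: sum_subtractf)

  have "(\<integral>\<omega>. log 2 (?p \<omega> / ?q \<omega>) \<partial>P) = (\<integral>\<omega>. log 2 (?p \<omega>) - log 2 (?q \<omega>) \<partial>P)"
  proof (rule integral_cong_AE)
    show "AE \<omega> in P. log 2 (?p \<omega> / ?q \<omega>) = log 2 (?p \<omega>) - log 2 (?q \<omega>)"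
      using qpos by eventually_elim (simp add: log_divide_pos)
  qed measurable
  also have "\<dots> = (\<integral>\<omega>. log 2 (?p \<omega>) \<partial>P) - (\<integral>\<omega>. log 2 (?q \<omega>) \<partial>P)"
    using integrable_block[of "\<lambda>xs. log 2 (block_mass P n xs)" n]
      integrable_block[of "\<lambda>xs. log 2 (pmf (Q n) xs)" n]
    by (rule Bochner_Integration.integral_diff)
  finally have ratio: "(\<integral>\<omega>. log 2 (?p \<omega> / ?q \<omega>) \<partial>P)
      = (\<integral>\<omega>. log 2 (?p \<omega>) \<partial>P) - (\<integral>\<omega>. log 2 (?q \<omega>) \<partial>P)" .

  have "(\<integral>\<omega>. Y \<omega> \<partial>P) = (\<integral>\<omega>. G \<omega> \<partial>P) - (\<Sum>t<n. \<integral>\<omega>. H t \<omega> \<partial>P) / real n"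
    unfolding Y_def using int_G int_H by simp
  also have "\<dots> = (\<integral>\<omega>. log 2 (?p \<omega> / ?q \<omega>) \<partial>P) / real n + (\<Sum>t<n. entropy_gap t) / real n"
    unfolding H_eq gaps ratio using n by (simp add: diff_divide_distrib)
  finally have int_Y_eq: "(\<integral>\<omega>. Y \<omega> \<partial>P)
      = (\<integral>\<omega>. log 2 (?p \<omega> / ?q \<omega>) \<partial>P) / real n + (\<Sum>t<n. entropy_gap t) / real n" .

  have "expected_divergence P (estimate K n) \<le> (\<integral>\<^sup>+ \<omega>. ennreal (Y \<omega>) \<partial>P)"
    unfolding expected_divergence_def
  proof (rule nn_integral_mono_AE)
    show "AE \<omega> in P. e2ennreal (info_div UNIV (?g \<omega>) (estimate K n \<omega>)) \<le> ennreal (Y \<omega>)"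
      using Y by eventually_elim (metis e2ennreal_ereal e2ennreal_mono)
  qed
  also have "\<dots> = ennreal (\<integral>\<omega>. Y \<omega> \<partial>P)"
    by (rule nn_integral_eq_integral[OF int_Y]) (use Y in \<open>auto elim!: eventually_mono\<close>)
  finally show ?thesis
    unfolding int_Y_eq .
qed

text \<open>
  If the law of \<open>X\<^sup>n\<close> is not dominated by the model, the right-hand side is infinite.
\<close>
lemma expected_divergence_le:
  assumes n: "0 < n" and K: "conditionals_of Q K" and supp: "set_pmf (Q n) \<subseteq> {xs. length xs = n}"
  shows "expected_divergence P (estimate K n)
    \<le> e2ennreal (info_div {xs. length xs = n} (block_mass P n) (pmf (Q n)) / ereal (real n)
        + ereal ((\<Sum>t<n. entropy_gap t) / real n))"
proof (cases "\<forall>xs. length xs = n \<longrightarrow> block_mass P n xs \<noteq> 0 \<longrightarrow> pmf (Q n) xs \<noteq> 0")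
  case True
  then show ?thesis
    using expected_divergence_le_if_dominated[OF n K supp] info_div_block_eq[of n "Q n"] n by simp
next
  case False
  then have "info_div {xs. length xs = n} (block_mass P n) (pmf (Q n)) = \<infinity>"
    using info_div_block_not_dominated by blast
  then show ?thesis
    using n by simp
qed

text \<open>
  The divergence is the expectation of the log ratio, hence at most that of its absolute value.
  Without domination the log ratio is infinite on an event of positive probability, and so is
  the integral.
\<close>
lemma info_div_rate_le_L1:
  assumes n: "0 < n"
  shows "info_div {xs. length xs = n} (block_mass P n) (pmf q) / ereal (real n)
    \<le> enn2ereal (\<integral>\<^sup>+ \<omega>. e2ennreal \<bar>log_ratio (block_mass P n (block n \<omega>)) (pmf q (block n \<omega>))
                            / ereal (real n)\<bar> \<partial>P)" (is "_ \<le> enn2ereal (\<integral>\<^sup>+ \<omega>. ?R \<omega> \<partial>P)")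
proof (cases "\<forall>xs. length xs = n \<longrightarrow> block_mass P n xs \<noteq> 0 \<longrightarrow> pmf q xs \<noteq> 0")
  case True
  let ?L = "\<lambda>\<omega>. log 2 (block_mass P n (block n \<omega>) / pmf q (block n \<omega>))"
  have int: "integrable P ?L"
    by (rule integrable_block)
  have "?R \<omega> = ennreal (\<bar>?L \<omega>\<bar> / real n)" for \<omega>
    using True n by (auto simp: log_ratio_def)
  then have "(\<integral>\<^sup>+ \<omega>. ?R \<omega> \<partial>P) = ennreal (\<integral>\<omega>. \<bar>?L \<omega>\<bar> / real n \<partial>P)"
    using int by (simp add: nn_integral_eq_integral)
  moreover have "(\<integral>\<omega>. ?L \<omega> \<partial>P) \<le> (\<integral>\<omega>. \<bar>?L \<omega>\<bar> \<partial>P)"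
    using int by (intro integral_mono) auto
  ultimately show ?thesis
    using True n by (simp add: info_div_block_eq divide_right_mono enn2ereal_ennreal)
next
  case False
  then obtain xs where xs: "length xs = n" "block_mass P n xs \<noteq> 0" "pmf q xs = 0"
    by blast
  let ?E = "{\<omega>. block n \<omega> = xs}"
  have "\<infinity> = \<infinity> * emeasure P ?E"
    using xs(2) by (auto simp: block_mass_eq measure_def ennreal_top_mult)
  also have "\<dots> = (\<integral>\<^sup>+ \<omega>. \<infinity> * indicator ?E \<omega> \<partial>P)"
    by (rule nn_integral_cmult_indicator[symmetric]) (rule block_event)
  also have "\<dots> \<le> (\<integral>\<^sup>+ \<omega>. ?R \<omega> \<partial>P)"
    by (rule nn_integral_mono) (use xs n in \<open>auto simp: indicator_def log_ratio_def\<close>)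
  finally have "(\<integral>\<^sup>+ \<omega>. ?R \<omega> \<partial>P) = \<infinity>"
    by (simp add: top_unique)
  then show ?thesis
    by simp
qed

end

theorem theorem6:
  fixes Q :: "nat \<Rightarrow> 'a::finite list pmf"
    and K :: "nat \<Rightarrow> 'a list \<Rightarrow> 'a pmf"
  assumes "\<And>n. n \<ge> 1 \<Longrightarrow> set_pmf (Q n) \<subseteq> {xs. length xs = n}"
    and "\<And>P. stationary P \<Longrightarrow>
           divergence_rate_vanishes P Q \<or> log_ratio_rate_vanishes_L1 P Q"
    and "conditionals_of Q K"
  shows "\<And>P. stationary P \<Longrightarrow> (\<lambda>n. expected_divergence P (estimate K n)) \<longlonglongrightarrow> 0"
proof -
  fix P :: "(int \<Rightarrow> 'a) measure"
  assume P: "stationary P"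
  then interpret stationary_process P
    by unfold_locales
  let ?D = "\<lambda>n. info_div {xs. length xs = n} (block_mass P n) (pmf (Q n)) / ereal (real n)"
  let ?G = "\<lambda>n. ereal ((\<Sum>t<n. entropy_gap t) / real n)"
  have bound: "expected_divergence P (estimate K n) \<le> e2ennreal (?D n + ?G n)" if "1 \<le> n" for n
    using that assms by (intro expected_divergence_le) auto
  have gap: "?G \<longlonglongrightarrow> ereal 0"
    by (intro tendsto_ereal Cesaro_mean_tendsto_0 entropy_gap_tendsto_0)
  obtain B where B: "B \<longlonglongrightarrow> 0" "\<And>n. 1 \<le> n \<Longrightarrow> ?D n \<le> B n"
  proof (cases "divergence_rate_vanishes P Q")
    case True
    then show ?thesis
      using that[of ?D] by (simp add: divergence_rate_vanishes_def)
  next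
    case False
    then have L1: "log_ratio_rate_vanishes_L1 P Q"
      using assms(2)[OF P] by blast
    show ?thesis
    proof (rule that)
      show "?D n \<le> enn2ereal (\<integral>\<^sup>+ \<omega>. e2ennreal \<bar>log_ratio (block_mass P n (block n \<omega>))
          (pmf (Q n) (block n \<omega>)) / ereal (real n)\<bar> \<partial>P)" if "1 \<le> n" for n
        using that by (intro info_div_rate_le_L1) simp
      show "(\<lambda>n. enn2ereal (\<integral>\<^sup>+ \<omega>. e2ennreal \<bar>log_ratio (block_mass P n (block n \<omega>))
          (pmf (Q n) (block n \<omega>)) / ereal (real n)\<bar> \<partial>P)) \<longlonglongrightarrow> 0"
        using tendsto_enn2erealI[OF L1[unfolded log_ratio_rate_vanishes_L1_def]]
        by (simp only: zero_ennreal.rep_eq)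
    qed
  qed
  have "(\<lambda>n. B n + ?G n) \<longlonglongrightarrow> 0 + ereal 0"
    by (rule tendsto_add_ereal) (use B(1) gap in auto)
  then have lim: "(\<lambda>n. e2ennreal (B n + ?G n)) \<longlonglongrightarrow> 0"
    using tendsto_e2ennrealI by fastforce
  have "expected_divergence P (estimate K n) \<le> e2ennreal (B n + ?G n)" if "1 \<le> n" for n
    using bound[OF that] e2ennreal_mono[OF add_right_mono[OF B(2)[OF that], of "?G n"]]
    by (rule order_trans)
  then show "(\<lambda>n. expected_divergence P (estimate K n)) \<longlonglongrightarrow> 0"
    by (intro tendsto_sandwich[OF _ _ tendsto_const lim]) (auto simp: eventually_sequentially)
qed

end
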